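(* Let $\Omega \subseteq \mathbb{R}^3$ be open, bounded and connected, and let $R:\Omega \to SO(3)$ be measurable. Suppose there is a constant matrix $\alpha \in \mathbb{R}^{3\times 3}$ such that $\operatorname{curl} R = \alpha$ in the sense of distributions. Then $R$ is constant (almost everywhere).
   Context: $SO(3)=\{A\in\mathbb{R}^{3\times3}: A^TA=Id,\ \det A=1\}$. For a matrix field $R$, $\operatorname{curl}$ is applied row-wise: $(\operatorname{curl} R)_{ij} = \varepsilon_{jkl}\,\partial_k R_{il}$ (Einstein summation, $\varepsilon_{jkl}$ the sign of the permutation $(jkl)$). Distributionally, $\operatorname{curl}R=\alpha$ means $-\int_\Omega \varepsilon_{jkl} R_{il}\,\partial_k\varphi\,dx = \int_\Omega \alpha_{ij}\varphi\,dx$ for all $\varphi\in C^\infty_c(\Omega)$ and all $i,j$. *)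

theory Defs
  imports "HOL-Analysis.Analysis" "HOL-Library.Numeral_Type"
begin

definition SO3 :: "(real^3^3) set" where
  "SO3 = {A. transpose A ** A = mat 1 \<and> det A = 1}"

definition levi_civita :: "3 \<Rightarrow> 3 \<Rightarrow> 3 \<Rightarrow> real" where
  "levi_civita j k l =
     (if j = k \<or> k = l \<or> j = l then 0
      else if (j, k, l) \<in> {(1, 2, 3), (2, 3, 1), (3, 1, 2)} then 1 else -1)"

definition partial_deriv :: "'n::finite \<Rightarrow> (real^'n \<Rightarrow> real) \<Rightarrow> real^'n \<Rightarrow> real" where
  "partial_deriv k f = (\<lambda>x. frechet_derivative f (at x) (axis k 1))"

fun iter_partial :: "'n::finite list \<Rightarrow> (real^'n \<Rightarrow> real) \<Rightarrow> real^'n \<Rightarrow> real" where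
  "iter_partial [] f = f"
| "iter_partial (k # ks) f = partial_deriv k (iter_partial ks f)"

definition smooth_fun :: "(real^'n::finite \<Rightarrow> real) \<Rightarrow> bool" where
  "smooth_fun f \<longleftrightarrow> (\<forall>ks x. iter_partial ks f differentiable (at x))"

text \<open>Test functions C_c^infinity(Omega), extended by zero to the whole space.\<close>
definition test_fun :: "(real^'n::finite) set \<Rightarrow> (real^'n \<Rightarrow> real) \<Rightarrow> bool" where
  "test_fun \<Omega> \<phi> \<longleftrightarrow> smooth_fun \<phi> \<and> compact (closure {x. \<phi> x \<noteq> 0})
                      \<and> closure {x. \<phi> x \<noteq> 0} \<subseteq> \<Omega>"

definition distrib_curl_eq :: "(real^3) set \<Rightarrow> (real^3 \<Rightarrow> real^3^3) \<Rightarrow> (real^3 \<Rightarrow> real^3^3) \<Rightarrow> bool" where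
  "distrib_curl_eq \<Omega> R \<alpha> \<longleftrightarrow>
     (\<forall>\<phi>. test_fun \<Omega> \<phi> \<longrightarrow> (\<forall>i j.
        - (\<integral>x. (\<Sum>k\<in>UNIV. \<Sum>l\<in>UNIV. levi_civita j k l * (R x $ i $ l) * partial_deriv k \<phi> x) \<partial>lebesgue_on \<Omega>)
        = (\<integral>x. (\<alpha> x $ i $ j) * \<phi> x \<partial>lebesgue_on \<Omega>)))"

end

theory Submission
  imports Defs
begin

text \<open>
  Write \<open>r\<^sub>i\<close> and \<open>\<alpha>\<^sub>i\<close> for the rows of \<open>R\<close> and \<open>\<alpha>\<close>. Since \<open>r\<^sub>1 = r\<^sub>2 \<times> r\<^sub>3\<close> (and cyclically), the
  divergence of each row is \<^emph>\<open>linear\<close> in \<open>R\<close>: \<open>div r\<^sub>1 = L\<^sub>1(R) = \<alpha>\<^sub>2 \<cdot> r\<^sub>3 - \<alpha>\<^sub>3 \<cdot> r\<^sub>2\<close>. Hence the mollified field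
  satisfies the same first-order system \<open>curl v\<^sub>i = \<alpha>\<^sub>i\<close>, \<open>div v\<^sub>i = L\<^sub>i(v)\<close>, although it leaves \<open>SO(3)\<close>.
  For a cutoff \<open>\<phi> \<ge> 0\<close> and smooth \<open>v\<close>,
  \<open>\<integral> \<phi> |\<nabla>v|\<^sup>2 = \<integral> \<phi> ((div v)\<^sup>2 + |curl v|\<^sup>2) + \<nabla>\<phi> \<cdot> (v div v + v \<times> curl v) + 1/2 \<Delta>\<phi> |v|\<^sup>2\<close>,
  while \<open>|\<nabla>v|\<^sup>2 \<ge> (div v)\<^sup>2 / 3 + |curl v|\<^sup>2 / 2\<close>. The resulting inequality contains no derivatives other than
  the prescribed ones, so it passes to the limit \<open>v \<rightarrow> R\<close>. There \<open>\<Sum> r\<^sub>i L\<^sub>i(R) = \<Sum> r\<^sub>i \<times> \<alpha>\<^sub>i\<close>,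
  \<open>\<integral> \<nabla>\<phi> \<cdot> (r\<^sub>i \<times> \<alpha>\<^sub>i) = - |\<alpha>\<^sub>i|\<^sup>2 \<integral> \<phi>\<close>, \<open>\<Sum> |r\<^sub>i|\<^sup>2 = 3\<close> and \<open>\<Sum> L\<^sub>i(R)\<^sup>2 \<le> 2 |\<alpha>|\<^sup>2\<close>, whence
  \<open>0 \<le> (4/3 + 1/2 - 2) |\<alpha>|\<^sup>2 \<integral> \<phi>\<close> and \<open>\<alpha> = 0\<close>. With \<open>\<alpha> = 0\<close> the identity shows
  \<open>\<integral> \<phi> |\<nabla>v|\<^sup>2 \<rightarrow> 3/2 \<integral> \<Delta>\<phi> = 0\<close>, so \<open>R\<close> has vanishing weak gradient.
\<close>

section \<open>Smooth functions and a smooth bump\<close>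

lemma partial_deriv_eq:
  assumes "(f has_derivative f') (at x)"
  shows "partial_deriv k f x = f' (axis k 1)"
  using frechet_derivative_at[OF assms] by (simp add: partial_deriv_def)

text \<open>Every iterated derivative of \<open>f\<close> stays in \<open>S\<close>, by induction on
  the index list. Smoothness of sums, products, bumps and convolutions is obtained by exhibiting
  such a class, without computing higher derivatives.\<close>

lemma smooth_fun_coinduct:
  assumes "f \<in> S" and "\<And>f x. f \<in> S \<Longrightarrow> f differentiable (at x)"
    and "\<And>f k. f \<in> S \<Longrightarrow> partial_deriv k f \<in> S"
  shows "smooth_fun f"
proof -
  have "iter_partial ks f \<in> S" for ks
    by (induction ks) (use assms in auto)
  then show ?thesis
    using assms(2) unfolding smooth_fun_def by blast
qed

lemma smooth_fun_differentiable: "smooth_fun f \<Longrightarrow> f differentiable (at x)"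
  unfolding smooth_fun_def by (metis iter_partial.simps(1))

lemma smooth_fun_partial_deriv:
  assumes "smooth_fun f" shows "smooth_fun (partial_deriv k f)"
proof -
  have "iter_partial ks (partial_deriv k f) = iter_partial (ks @ [k]) f" for ks
    by (induction ks) auto
  then show ?thesis
    using assms unfolding smooth_fun_def by metis
qed

lemma smooth_fun_continuous_on: "smooth_fun f \<Longrightarrow> continuous_on S f"
  by (meson continuous_at_imp_continuous_on differentiable_imp_continuous_within smooth_fun_differentiable)

lemma smooth_fun_borel [measurable]: "smooth_fun f \<Longrightarrow> f \<in> borel_measurable borel"
  by (simp add: borel_measurable_continuous_onI smooth_fun_continuous_on)

lemma has_derivative_partial_derivs:
  fixes f :: "real^'n::finite \<Rightarrow> real"
  assumes "f differentiable (at x)"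
  shows "(f has_derivative (\<lambda>h. \<Sum>k\<in>UNIV. h $ k * partial_deriv k f x)) (at x)"
proof -
  obtain f' where f': "(f has_derivative f') (at x)"
    using assms by (auto simp: differentiable_def)
  have lin: "linear f'"
    using f' has_derivative_linear by blast
  have "f' h = (\<Sum>k\<in>UNIV. h $ k * partial_deriv k f x)" for h
  proof -
    have "f' h = f' (\<Sum>k\<in>UNIV. h $ k *s axis k 1)"
      by (simp add: basis_expansion)
    also have "\<dots> = (\<Sum>k\<in>UNIV. h $ k * f' (axis k 1))"
      by (simp add: linear_sum[OF lin] linear_cmul[OF lin] scalar_mult_eq_scaleR)
    finally show ?thesis
      by (simp add: partial_deriv_eq[OF f'])
  qed
  then have "f' = (\<lambda>h. \<Sum>k\<in>UNIV. h $ k * partial_deriv k f x)" by blast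
  then show ?thesis using f' by simp
qed

lemma partial_deriv_mult:
  assumes "f differentiable (at x)" "g differentiable (at x)"
  shows "partial_deriv k (\<lambda>x. f x * g x) x = partial_deriv k f x * g x + f x * partial_deriv k g x"
proof -
  obtain f' g' where f: "(f has_derivative f') (at x)" and g: "(g has_derivative g') (at x)"
    using assms by (auto simp: differentiable_def)
  from has_derivative_mult[OF f g] show ?thesis
    by (simp add: partial_deriv_eq[OF f] partial_deriv_eq[OF g] partial_deriv_eq)
qed

lemma partial_deriv_add:
  assumes "f differentiable (at x)" "g differentiable (at x)"
  shows "partial_deriv k (\<lambda>x. f x + g x) x = partial_deriv k f x + partial_deriv k g x"
proof -
  obtain f' g' where f: "(f has_derivative f') (at x)" and g: "(g has_derivative g') (at x)"
    using assms by (auto simp: differentiable_def)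
  from has_derivative_add[OF f g] show ?thesis
    by (simp add: partial_deriv_eq[OF f] partial_deriv_eq[OF g] partial_deriv_eq)
qed

lemma partial_deriv_const [simp]: "partial_deriv k (\<lambda>x. c) x = 0"
  using partial_deriv_eq[OF has_derivative_const] by fastforce

section \<open>The flat exponential and the smooth bump\<close>

definition flat_exp :: "nat \<Rightarrow> real \<Rightarrow> real" where
  "flat_exp n t = (if t > 0 then (1 / t) ^ n * exp (- (1 / t)) else 0)"

lemma flat_exp_tendsto_0: "(flat_exp n \<longlongrightarrow> 0) (at 0)"
proof -
  have "((\<lambda>t::real. inverse t ^ n / exp (inverse t)) \<longlongrightarrow> 0) (at_right 0)"
    by (rule filterlim_compose[OF tendsto_power_div_exp_0 filterlim_inverse_at_top_right])
  then have "(flat_exp n \<longlongrightarrow> 0) (at_right 0)"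
    by (rule Lim_transform_eventually)
      (auto simp: eventually_at_filter flat_exp_def exp_minus inverse_eq_divide)
  moreover have "(flat_exp n \<longlongrightarrow> 0) (at_left 0)"
    by (rule Lim_transform_eventually[OF tendsto_const[of 0]])
      (auto simp: eventually_at_filter flat_exp_def)
  ultimately show ?thesis
    by (simp add: filterlim_split_at_real)
qed

text \<open>The powers of \<open>1 / t\<close> are carried along in \<open>flat_exp\<close> so that
  the derivative is again a linear combination of members of the family; one limit at the origin
  then serves derivatives of all orders.\<close>

lemma flat_exp_has_derivative:
  "(flat_exp n has_real_derivative (flat_exp (n + 2) t - real n * flat_exp (n + 1) t)) (at t)"
proof (cases t "0::real" rule: linorder_cases)
  case less
  have "(flat_exp n has_real_derivative 0) (at t)"
    by (rule has_field_derivative_transform_within_open[where S="{..<0}" and f="\<lambda>_. 0"])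
      (use less in \<open>auto simp: flat_exp_def\<close>)
  then show ?thesis using less by (simp add: flat_exp_def)
next
  case equal
  \<comment> \<open>For nonzero \<open>h\<close> the difference quotient is exactly
    \<open>flat_exp (Suc n) h\<close>: dividing by \<open>h\<close> raises the power of
    \<open>1 / h\<close> by one.\<close>
  have "((\<lambda>h. (flat_exp n (0 + h) - flat_exp n 0) / h) \<longlongrightarrow> 0) (at 0)"
    by (rule Lim_transform_eventually[OF flat_exp_tendsto_0[of "Suc n"]])
      (auto simp: eventually_at_filter flat_exp_def)
  then show ?thesis
    using equal by (simp add: DERIV_def flat_exp_def)
next
  case greater
  have d: "((\<lambda>t. (1 / t) ^ n * exp (- (1 / t))) has_real_derivative
      (1 / t) ^ (n + 2) * exp (- (1 / t)) - real n * ((1 / t) ^ (n + 1) * exp (- (1 / t)))) (at t)"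
    apply (rule derivative_eq_intros refl | use greater in force)+
    using greater
    apply (cases n)
     apply (simp_all add: field_simps power2_eq_square)
    done
  have "(flat_exp n has_real_derivative
      (1 / t) ^ (n + 2) * exp (- (1 / t)) - real n * ((1 / t) ^ (n + 1) * exp (- (1 / t)))) (at t)"
    by (rule has_field_derivative_transform_within_open[OF d, where S="{0<..}"])
      (use greater in \<open>auto simp: flat_exp_def\<close>)
  then show ?thesis using greater by (simp add: flat_exp_def)
qed

text \<open>A class closed under partial derivatives: a derivative of \<open>profile\<close> is a
  combination of profiles times an affine function of one coordinate, and sums and products obey the
  Leibniz rules. One use of \<open>smooth_fun_coinduct\<close> then yields the smoothness of the
  bump and, through \<open>base\<close>, of sums and products of arbitrary smooth functions.\<close>

inductive smooth_gen :: "(real^'n::finite \<Rightarrow> real) \<Rightarrow> bool" where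
  base: "smooth_fun f \<Longrightarrow> smooth_gen f"
| const: "smooth_gen (\<lambda>x. c)"
| coord: "smooth_gen (\<lambda>x. x $ k)"
| profile: "smooth_gen (\<lambda>x. flat_exp n (c - (x - a) \<bullet> (x - a)))"
| add: "smooth_gen f \<Longrightarrow> smooth_gen g \<Longrightarrow> smooth_gen (\<lambda>x. f x + g x)"
| mult: "smooth_gen f \<Longrightarrow> smooth_gen g \<Longrightarrow> smooth_gen (\<lambda>x. f x * g x)"

lemma profile_has_derivative:
  fixes a x :: "real^'n::finite"
  shows "((\<lambda>x. flat_exp n (c - (x - a) \<bullet> (x - a))) has_derivative
    (\<lambda>h. (flat_exp (n + 2) (c - (x - a) \<bullet> (x - a)) - real n * flat_exp (n + 1) (c - (x - a) \<bullet> (x - a)))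
      * (- 2 * ((x - a) \<bullet> h)))) (at x)"
proof -
  have "((\<lambda>x. c - (x - a) \<bullet> (x - a)) has_derivative (\<lambda>h. - 2 * ((x - a) \<bullet> h))) (at x)"
    by (auto intro!: derivative_eq_intros simp: inner_commute)
  from has_derivative_compose[OF this has_field_derivative_imp_has_derivative[OF flat_exp_has_derivative]]
  show ?thesis .
qed

lemma partial_deriv_profile:
  fixes a x :: "real^'n::finite"
  shows "partial_deriv k (\<lambda>x. flat_exp n (c - (x - a) \<bullet> (x - a))) x =
    (flat_exp (n + 2) (c - (x - a) \<bullet> (x - a)) + (- real n) * flat_exp (n + 1) (c - (x - a) \<bullet> (x - a)))
      * (- 2 * (x $ k + (- a $ k)))"
  by (subst partial_deriv_eq[OF profile_has_derivative]) (simp add: inner_axis)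

lemma partial_deriv_coord: "partial_deriv k (\<lambda>x::real^'n::finite. x $ j) x = (if j = k then 1 else 0)"
proof -
  have "((\<lambda>x::real^'n. x $ j) has_derivative (\<lambda>h. h $ j)) (at x)"
    by (rule bounded_linear_imp_has_derivative) (rule bounded_linear_vec_nth)
  then show ?thesis by (simp add: partial_deriv_eq axis_def)
qed

lemma smooth_gen_differentiable: "smooth_gen f \<Longrightarrow> f differentiable (at x)"
proof (induction rule: smooth_gen.induct)
  case (coord k)
  show ?case by (simp add: bounded_linear_imp_differentiable bounded_linear_vec_nth)
next
  case (profile n c a)
  show ?case using profile_has_derivative[of n c a x] unfolding differentiable_def by blast
qed (auto simp: smooth_fun_differentiable)

lemma smooth_gen_partial_deriv:
  fixes f :: "real^'n::finite \<Rightarrow> real"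
  shows "smooth_gen f \<Longrightarrow> smooth_gen (partial_deriv k f)"
proof (induction rule: smooth_gen.induct)
  case (base f)
  then show ?case by (simp add: smooth_fun_partial_deriv smooth_gen.base)
next
  case (const c)
  have "partial_deriv k (\<lambda>x::real^'n. c) = (\<lambda>x. 0)" by (rule ext) simp
  then show ?case using smooth_gen.const by metis
next
  case (coord j)
  have "partial_deriv k (\<lambda>x::real^'n. x $ j) = (\<lambda>x. if j = k then 1 else 0)"
    by (rule ext) (rule partial_deriv_coord)
  then show ?case using smooth_gen.const by metis
next
  case (profile n c a)
  have "partial_deriv k (\<lambda>x. flat_exp n (c - (x - a) \<bullet> (x - a))) = (\<lambda>x.
    (flat_exp (n + 2) (c - (x - a) \<bullet> (x - a)) + (- real n) * flat_exp (n + 1) (c - (x - a) \<bullet> (x - a)))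
      * (- 2 * (x $ k + (- a $ k))))"
    by (rule ext) (rule partial_deriv_profile)
  moreover have "smooth_gen (\<lambda>x.
    (flat_exp (n + 2) (c - (x - a) \<bullet> (x - a)) + (- real n) * flat_exp (n + 1) (c - (x - a) \<bullet> (x - a)))
      * (- 2 * (x $ k + (- a $ k))))"
    by (intro smooth_gen.intros)
  ultimately show ?case by metis
next
  case (add f g)
  have "partial_deriv k (\<lambda>x. f x + g x) = (\<lambda>x. partial_deriv k f x + partial_deriv k g x)"
    using add by (intro ext partial_deriv_add smooth_gen_differentiable)
  then show ?case using add by (simp add: smooth_gen.add)
next
  case (mult f g)
  have "partial_deriv k (\<lambda>x. f x * g x) = (\<lambda>x. partial_deriv k f x * g x + f x * partial_deriv k g x)"
    using mult by (intro ext partial_deriv_mult smooth_gen_differentiable)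
  then show ?case using mult by (simp add: smooth_gen.add smooth_gen.mult)
qed

lemma smooth_gen_smooth_fun: "smooth_gen f \<Longrightarrow> smooth_fun f"
  by (rule smooth_fun_coinduct[where S="Collect smooth_gen"])
    (auto simp: smooth_gen_differentiable smooth_gen_partial_deriv)

lemma smooth_fun_add: "smooth_fun f \<Longrightarrow> smooth_fun g \<Longrightarrow> smooth_fun (\<lambda>x. f x + g x)"
  by (simp add: smooth_gen_smooth_fun smooth_gen.add smooth_gen.base)

lemma smooth_fun_mult: "smooth_fun f \<Longrightarrow> smooth_fun g \<Longrightarrow> smooth_fun (\<lambda>x. f x * g x)"
  by (simp add: smooth_gen_smooth_fun smooth_gen.mult smooth_gen.base)

lemma smooth_fun_const: "smooth_fun (\<lambda>x. c)"
  by (simp add: smooth_gen_smooth_fun smooth_gen.const)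

lemma smooth_fun_diff:
  assumes "smooth_fun f" "smooth_fun g" shows "smooth_fun (\<lambda>x. f x - g x)"
  using smooth_fun_add[OF assms(1) smooth_fun_mult[OF smooth_fun_const[of "-1"] assms(2)]] by simp

lemmas smooth_intros = smooth_fun_add smooth_fun_mult smooth_fun_const smooth_fun_diff
  smooth_fun_partial_deriv

lemma partial_deriv_diff:
  assumes "f differentiable (at x)" "g differentiable (at x)"
  shows "partial_deriv k (\<lambda>x. f x - g x) x = partial_deriv k f x - partial_deriv k g x"
proof -
  obtain f' g' where f: "(f has_derivative f') (at x)" and g: "(g has_derivative g') (at x)"
    using assms by (auto simp: differentiable_def)
  from has_derivative_diff[OF f g] show ?thesis
    by (simp add: partial_deriv_eq[OF f] partial_deriv_eq[OF g] partial_deriv_eq)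
qed

text \<open>For \<open>r > 0\<close> this is \<open>exp (- 1 / (r^2 - |x - a|^2))\<close> inside the
  open ball of radius \<open>r\<close> about \<open>a\<close> and zero elsewhere; it is not
  normalised.\<close>

definition bump :: "real^'n::finite \<Rightarrow> real \<Rightarrow> real^'n \<Rightarrow> real" where
  "bump a r x = flat_exp 0 (r\<^sup>2 - (x - a) \<bullet> (x - a))"

lemma smooth_fun_bump [simp]: "smooth_fun (bump a r)"
  unfolding bump_def[abs_def] by (intro smooth_gen_smooth_fun smooth_gen.profile)

lemma bump_nonneg [simp]: "bump a r x \<ge> 0"
  by (simp add: bump_def flat_exp_def)

lemma bump_pos_iff:
  assumes "r > 0" shows "bump a r x > 0 \<longleftrightarrow> dist x a < r"
proof -
  have "(x - a) \<bullet> (x - a) < r\<^sup>2 \<longleftrightarrow> dist x a < r"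
    using assms power_mono_iff[of r "dist x a" 2]
    by (simp add: dist_norm power2_norm_eq_inner not_le[symmetric])
  then show ?thesis
    by (simp add: bump_def flat_exp_def zero_less_mult_iff)
qed

lemma bump_eq_0:
  assumes "r > 0" "dist x a \<ge> r" shows "bump a r x = 0"
  using bump_pos_iff[OF assms(1), of a x] assms(2) bump_nonneg[of a r x] by linarith

lemma test_fun_bump:
  assumes "r > 0" "cball a r \<subseteq> S" shows "test_fun S (bump a r)"
proof -
  have sub: "{x. bump a r x \<noteq> 0} \<subseteq> cball a r"
    using bump_eq_0[OF assms(1)] by (force simp: dist_commute)
  then have "closure {x. bump a r x \<noteq> 0} \<subseteq> cball a r"
    by (simp add: closure_minimal)
  moreover have "bounded {x. bump a r x \<noteq> 0}"
    using sub bounded_cball bounded_subset by blast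
  ultimately show ?thesis
    using assms by (auto simp: test_fun_def)
qed

text \<open>Direct computation: for \<open>j \<noteq> k\<close> the mixed derivative is
  \<open>4 * (P 4 - 2 * P 3)\<close> times the two coordinates of \<open>x - a\<close>, which is
  symmetric. Convolution later transfers this symmetry to the mollified field.\<close>

lemma partial_deriv_bump_commute:
  "partial_deriv j (partial_deriv k (bump a r)) = partial_deriv k (partial_deriv j (bump a r))"
  (is "?L = ?R")
proof (cases "j = k")
  case False
  define P where "P n = (\<lambda>x. flat_exp n (r\<^sup>2 - (x - a) \<bullet> (x - a)))" for n
  have d: "P n differentiable (at x)" for n x
    unfolding P_def by (intro smooth_gen_differentiable smooth_gen.profile)
  have 1: "partial_deriv i (bump a r) = (\<lambda>x. P 2 x * (- 2 * (x $ i - a $ i)))" for i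
    by (rule ext) (simp only: partial_deriv_profile bump_def[abs_def], simp add: P_def numeral_2_eq_2)
  have 2: "partial_deriv j (\<lambda>x. P 2 x * (- 2 * (x $ i - a $ i))) x =
      4 * (P 4 x - 2 * P 3 x) * (x $ i - a $ i) * (x $ j - a $ j)" if "i \<noteq> j" for i j x
  proof -
    have "((\<lambda>x. - 2 * (x $ i - a $ i)) has_derivative (\<lambda>h. - 2 * h $ i)) (at x)"
      by (auto intro!: derivative_eq_intros bounded_linear_imp_has_derivative bounded_linear_vec_nth)
    then have q: "partial_deriv j (\<lambda>x. - 2 * (x $ i - a $ i)) x = 0"
      and q': "(\<lambda>x. - 2 * (x $ i - a $ i)) differentiable (at x)"
      using that by (auto simp: partial_deriv_eq axis_def differentiable_def)
    have "partial_deriv j (P 2) x = (P 4 x - 2 * P 3 x) * (- 2 * (x $ j - a $ j))"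
      unfolding P_def by (subst partial_deriv_profile) simp
    then show ?thesis
      by (subst partial_deriv_mult[OF d q']) (simp only: q, simp add: algebra_simps)
  qed
  show ?thesis
    unfolding 1 by (rule ext) (simp only: 2[OF False] 2[OF not_sym[OF False]], simp only: mult_ac)
qed simp

section \<open>Convolution and integration by parts\<close>

definition vanishes_beyond :: "real \<Rightarrow> ('a::real_normed_vector \<Rightarrow> real) \<Rightarrow> bool" where
  "vanishes_beyond r f \<longleftrightarrow> (\<forall>x. norm x > r \<longrightarrow> f x = 0)"

lemma vanishes_beyondD: "vanishes_beyond r f \<Longrightarrow> norm x > r \<Longrightarrow> f x = 0"
  by (simp add: vanishes_beyond_def)

lemma integrable_bounded_support:
  fixes f :: "'a::euclidean_space \<Rightarrow> real"
  assumes [measurable]: "f \<in> borel_measurable borel"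
    and bnd: "\<And>x. \<bar>f x\<bar> \<le> C" and supp: "vanishes_beyond r f"
  shows "integrable lborel f"
proof (rule Bochner_Integration.integrable_bound[where f="\<lambda>x. C * indicator (cball 0 r) x"])
  have "emeasure lborel (cball (0::'a) r) < \<infinity>"
    using emeasure_bounded_finite[OF bounded_cball] by blast
  then show "integrable lborel (\<lambda>x::'a. C * indicator (cball 0 r) x)"
    by (simp add: integrable_real_indicator)
  show "AE x in lborel. norm (f x) \<le> norm (C * indicator (cball 0 r) x)"
  proof (rule AE_I2)
    fix x
    show "norm (f x) \<le> norm (C * indicator (cball 0 r) x)"
      using bnd[of x] vanishes_beyondD[OF supp, of x] by (cases "norm x \<le> r") auto
  qed
qed simp

lemma compact_support_bounded:
  fixes f :: "'a::euclidean_space \<Rightarrow> real"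
  assumes "continuous_on UNIV f" "vanishes_beyond r f"
  obtains C where "C > 0" "\<And>x. \<bar>f x\<bar> \<le> C"
proof -
  have "bounded (f ` cball 0 r)"
    by (intro compact_imp_bounded compact_continuous_image continuous_on_subset[OF assms(1)]) auto
  then obtain C where C: "\<forall>y\<in>f ` cball 0 r. norm y \<le> C"
    unfolding bounded_iff by blast
  have "\<bar>f x\<bar> \<le> \<bar>C\<bar> + 1" for x
  proof (cases "norm x \<le> r")
    case True
    then have "norm (f x) \<le> C" using C by simp
    then show ?thesis by simp
  next
    case False
    then show ?thesis using vanishes_beyondD[OF assms(2)] by simp
  qed
  moreover have "\<bar>C\<bar> + 1 > 0" by simp
  ultimately show ?thesis by (rule that[rotated])
qed

lemma integrable_compact_support:
  fixes f :: "'a::euclidean_space \<Rightarrow> real"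
  assumes "continuous_on UNIV f" "vanishes_beyond r f"
  shows "integrable lborel f"
proof -
  obtain C where "\<And>x. \<bar>f x\<bar> \<le> C" using compact_support_bounded[OF assms] by blast
  then show ?thesis
    using assms by (intro integrable_bounded_support[of f C r]) (auto intro: borel_measurable_continuous_onI)
qed

text \<open>Two points at distance less than 1 either both lie in the ball of radius
  \<open>r + 1\<close>, where compactness applies, or both lie beyond \<open>r\<close>, where
  \<open>f\<close> is zero.\<close>

lemma compact_support_uniformly_continuous:
  fixes f :: "'a::euclidean_space \<Rightarrow> real"
  assumes "continuous_on UNIV f" "vanishes_beyond r f"
  shows "uniformly_continuous_on UNIV f"
proof (unfold uniformly_continuous_on_def, intro allI impI ballI)
  fix e :: real assume "e > 0"
  have "uniformly_continuous_on (cball 0 (r + 1)) f"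
    by (rule compact_uniformly_continuous[OF continuous_on_subset[OF assms(1)]]) auto
  with \<open>e > 0\<close> obtain d where d: "d > 0"
    "\<And>x y. x \<in> cball 0 (r + 1) \<Longrightarrow> y \<in> cball 0 (r + 1) \<Longrightarrow> dist y x < d \<Longrightarrow> dist (f y) (f x) < e"
    unfolding uniformly_continuous_on_def by blast
  have "dist (f y) (f x) < e" if "dist y x < min d 1" for x y
  proof (cases "norm x \<le> r + 1 \<and> norm y \<le> r + 1")
    case True
    then show ?thesis using d that by auto
  next
    case False
    have "\<bar>norm x - norm y\<bar> < 1"
      using that norm_triangle_ineq3[of y x] by (auto simp: dist_norm)
    with False have "norm x > r" "norm y > r" by linarith+
    then show ?thesis using vanishes_beyondD[OF assms(2)] \<open>e > 0\<close> by simp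
  qed
  moreover have "min d 1 > 0" using d(1) by simp
  ultimately show "\<exists>d>0. \<forall>x\<in>UNIV. \<forall>y\<in>UNIV. dist y x < d \<longrightarrow> dist (f y) (f x) < e"
    by blast
qed

lemma partial_deriv_vanishes:
  assumes "open S" "x \<in> S" "\<And>y. y \<in> S \<Longrightarrow> f y = c"
  shows "partial_deriv k f x = 0"
proof -
  have "(f has_derivative (\<lambda>h. 0)) (at x)"
    by (rule has_derivative_transform_within_open[OF has_derivative_const assms(1,2)]) (simp add: assms(3))
  then show ?thesis by (simp add: partial_deriv_eq)
qed

lemma partial_deriv_support:
  fixes f :: "real^'n::finite \<Rightarrow> real"
  assumes "vanishes_beyond r f"
  shows "vanishes_beyond r (partial_deriv k f)"
  unfolding vanishes_beyond_def
proof (intro allI impI)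
  fix x :: "real^'n" assume "norm x > r"
  moreover have "open {x::real^'n. norm x > r}"
    by (intro open_Collect_less continuous_intros)
  ultimately show "partial_deriv k f x = 0"
    using assms by (intro partial_deriv_vanishes[of "{x. norm x > r}" x f 0]) (auto simp: vanishes_beyond_def)
qed

section \<open>Convolution with a smooth kernel and its derivatives\<close>

definition conv :: "(real^'n::finite \<Rightarrow> real) \<Rightarrow> (real^'n \<Rightarrow> real) \<Rightarrow> real^'n \<Rightarrow> real" where
  "conv f g x = (\<integral>y. f y * g (x - y) \<partial>lborel)"

lemma conv_integrable:
  fixes f g :: "real^'n::finite \<Rightarrow> real"
  assumes f: "integrable lborel f"
    and g: "continuous_on UNIV g" "vanishes_beyond r g"
  shows "integrable lborel (\<lambda>y. f y * g (x - y))"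
proof -
  obtain C where C: "\<And>x. \<bar>g x\<bar> \<le> C" "C > 0" using compact_support_bounded[OF g] by blast
  have [measurable]: "g \<in> borel_measurable borel"
    by (simp add: borel_measurable_continuous_onI g(1))
  have [measurable]: "f \<in> borel_measurable borel"
    using f by (simp add: borel_measurable_integrable)
  show ?thesis
  proof (rule Bochner_Integration.integrable_bound[where f="\<lambda>y. C * f y"])
    show "AE y in lborel. norm (f y * g (x - y)) \<le> norm (C * f y)"
      using C by (intro AE_I2) (simp add: abs_mult mult.commute[of C] mult_left_mono)
  qed (use f in simp_all)
qed

text \<open>The partial derivatives are uniformly continuous by compact support, so the mean value
  inequality bounds the first-order Taylor remainder with one \<open>d\<close> for all base points
  \<open>z\<close>. This uniformity allows the bound to be integrated against an integrable
  function.\<close>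

lemma smooth_fun_uniform_linearization:
  fixes g :: "real^'n::finite \<Rightarrow> real"
  assumes g: "smooth_fun g" "vanishes_beyond r g" and "e > 0"
  obtains d where "d > 0" "\<And>z h. norm h < d \<Longrightarrow>
    \<bar>g (z + h) - g z - (\<Sum>k\<in>UNIV. h $ k * partial_deriv k g z)\<bar> \<le> norm h * e"
proof -
  let ?D = "\<lambda>k. partial_deriv k g"
  \<comment> \<open>The operator norm of a difference of gradients is estimated by the sum over its
    coordinates, each allowed a share \<open>e'\<close>.\<close>
  define e' where "e' = e / real CARD('n)"
  have e': "e' > 0" using \<open>e > 0\<close> by (simp add: e'_def)
  have "\<forall>k. \<exists>d>0. \<forall>x y. dist y x < d \<longrightarrow> dist (?D k y) (?D k x) < e'"
  proof
    fix k
    have "uniformly_continuous_on UNIV (?D k)"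
      by (intro compact_support_uniformly_continuous[of _ r] smooth_fun_continuous_on
          smooth_fun_partial_deriv partial_deriv_support g)
    then show "\<exists>d>0. \<forall>x y. dist y x < d \<longrightarrow> dist (?D k y) (?D k x) < e'"
      using e' unfolding uniformly_continuous_on_def by (metis UNIV_I)
  qed
  then obtain d where d: "\<And>k. d k > 0" "\<And>k x y. dist y x < d k \<Longrightarrow> dist (?D k y) (?D k x) < e'"
    by metis
  define d0 where "d0 = Min (range d)"
  have d0: "d0 > 0" "\<And>k. d0 \<le> d k"
    using d(1) by (auto simp: d0_def)
  have "\<bar>g (z + h) - g z - (\<Sum>k\<in>UNIV. h $ k * ?D k z)\<bar> \<le> norm h * e" if "norm h < d0" for z h
  proof -
    let ?f' = "\<lambda>x h. \<Sum>k\<in>UNIV. h $ k * ?D k x"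
    have "norm (g (z + h) - g z - ?f' z (z + h - z)) \<le> norm (z + h - z) * e"
    proof (rule differentiable_bound_linearization[where S="ball z d0" and f'="?f'"])
      fix t :: real assume t: "t \<in> {0..1}"
      have "\<bar>t\<bar> * norm h \<le> 1 * norm h"
        using t by (intro mult_right_mono) auto
      then show "z + t *\<^sub>R (z + h - z) \<in> ball z d0"
        using that by (simp add: dist_norm)
    next
      fix x assume "x \<in> ball z d0"
      then have x: "dist (?D k x) (?D k z) < e'" for k
        using d(2)[of x z k] d0(2)[of k] by (auto simp: dist_commute)
      show "(g has_derivative ?f' x) (at x within ball z d0)"
        by (rule has_derivative_at_withinI[OF has_derivative_partial_derivs[OF smooth_fun_differentiable[OF g(1)]]])
      show "onorm (?f' x - ?f' z) \<le> e"
      proof (rule onorm_le)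
        fix h :: "real^'n"
        have "norm ((?f' x - ?f' z) h) = \<bar>\<Sum>k\<in>UNIV. h $ k * (?D k x - ?D k z)\<bar>"
          by (simp add: sum_subtractf algebra_simps)
        also have "\<dots> \<le> (\<Sum>k\<in>(UNIV::'n set). norm h * e')"
        proof (rule order_trans[OF sum_abs], rule sum_mono)
          fix k :: 'n
          show "\<bar>h $ k * (?D k x - ?D k z)\<bar> \<le> norm h * e'"
            unfolding abs_mult using x[of k] component_le_norm_cart[of h k]
            by (intro mult_mono) (auto simp: dist_norm)
        qed
        also have "\<dots> = e * norm h"
          by (simp add: e'_def)
        finally show "norm ((?f' x - ?f' z) h) \<le> e * norm h" .
      qed
    qed (use d0 in auto)
    then show ?thesis by simp
  qed
  with d0(1) show ?thesis using that by blast
qed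

text \<open>The remainder of \<open>g\<close> at \<open>x - y\<close> is at most
  \<open>norm h * e'\<close> uniformly in \<open>y\<close>, so the remainder of the convolution is
  at most this bound times the L1 norm of \<open>f\<close>.\<close>

lemma conv_has_derivative:
  fixes f g :: "real^'n::finite \<Rightarrow> real"
  assumes f: "integrable lborel f"
    and g: "smooth_fun g" "vanishes_beyond r g"
  shows "(conv f g has_derivative (\<lambda>h. \<Sum>k\<in>UNIV. h $ k * conv f (partial_deriv k g) x)) (at x)"
proof (subst has_derivative_at_alt, intro conjI allI impI)
  show "bounded_linear (\<lambda>h. \<Sum>k\<in>UNIV. h $ k * conv f (partial_deriv k g) x)"
    by (intro bounded_linear_sum bounded_linear_mult_const bounded_linear_vec_nth)
  let ?D = "\<lambda>k. partial_deriv k g"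
  have ig: "integrable lborel (\<lambda>y. f y * g (x - y))" for x
    by (rule conv_integrable[OF f smooth_fun_continuous_on[OF g(1)] g(2)])
  have iD: "integrable lborel (\<lambda>y. f y * ?D k (x - y))" for x k
    by (intro conv_integrable[OF f, of _ r] smooth_fun_continuous_on smooth_fun_partial_deriv
        partial_deriv_support g)
  fix e :: real assume "e > 0"
  define N where "N = (\<integral>y. \<bar>f y\<bar> \<partial>lborel)"
  have N: "N \<ge> 0" by (simp add: N_def)
  \<comment> \<open>The added 1 keeps the quotient defined when \<open>f\<close> is zero almost
    everywhere, and still \<open>N * e' \<le> e\<close>.\<close>
  define e' where "e' = e / (N + 1)"
  have e': "e' > 0" using N \<open>e > 0\<close> by (simp add: e'_def)
  obtain d where d: "d > 0" and lin: "\<And>z h. norm h < d \<Longrightarrow>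
      \<bar>g (z + h) - g z - (\<Sum>k\<in>UNIV. h $ k * ?D k z)\<bar> \<le> norm h * e'"
    using smooth_fun_uniform_linearization[OF g e'] by blast
  have "norm (conv f g x' - conv f g x - (\<Sum>k\<in>UNIV. (x' - x) $ k * conv f (?D k) x)) \<le> e * norm (x' - x)"
    if "norm (x' - x) < d" for x'
  proof -
    define h where "h = x' - x"
    let ?r = "\<lambda>y. g (x' - y) - g (x - y) - (\<Sum>k\<in>UNIV. h $ k * ?D k (x - y))"
    have eq: "f y * ?r y = f y * g (x' - y) - f y * g (x - y) - (\<Sum>k\<in>UNIV. h $ k * (f y * ?D k (x - y)))" for y
      by (simp add: sum_distrib_left algebra_simps)
    have i: "integrable lborel (\<lambda>y. f y * ?r y)"
      unfolding eq by (intro Bochner_Integration.integrable_diff Bochner_Integration.integrable_sum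
        integrable_mult_right ig iD)
    have "conv f g x' - conv f g x - (\<Sum>k\<in>UNIV. h $ k * conv f (?D k) x) = (\<integral>y. f y * ?r y \<partial>lborel)"
      unfolding eq conv_def
      by (simp add: Bochner_Integration.integral_diff Bochner_Integration.integral_sum ig iD)
    also have "norm \<dots> \<le> (\<integral>y. norm (f y * ?r y) \<partial>lborel)"
      by (rule integral_norm_bound)
    also have "\<dots> \<le> (\<integral>y. \<bar>f y\<bar> * (norm h * e') \<partial>lborel)"
    proof (rule integral_mono)
      show "integrable lborel (\<lambda>y. norm (f y * ?r y))" using i by (rule integrable_norm)
      show "integrable lborel (\<lambda>y. \<bar>f y\<bar> * (norm h * e'))" using f by simp
      fix y
      have "x - y + h = x' - y" by (simp add: h_def)
      then have "\<bar>?r y\<bar> \<le> norm h * e'"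
        using lin[of h "x - y"] that by (simp only: h_def[symmetric])
      then show "norm (f y * ?r y) \<le> \<bar>f y\<bar> * (norm h * e')"
        by (simp add: abs_mult mult_left_mono)
    qed
    also have "\<dots> = norm h * (N * e')" by (simp add: N_def)
    also have "\<dots> \<le> norm h * e"
      using N \<open>e > 0\<close> by (intro mult_left_mono) (auto simp: e'_def field_simps)
    finally show ?thesis by (simp add: h_def mult.commute)
  qed
  then show "\<exists>d>0. \<forall>y. norm (y - x) < d \<longrightarrow>
      norm (conv f g y - conv f g x - (\<Sum>k\<in>UNIV. (y - x) $ k * conv f (partial_deriv k g) x)) \<le> e * norm (y - x)"
    using d by (intro exI[of _ d] conjI allI impI)
qed

lemma conv_partial_deriv:
  fixes f g :: "real^'n::finite \<Rightarrow> real"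
  assumes "integrable lborel f" "smooth_fun g" "vanishes_beyond r g"
  shows "partial_deriv k (conv f g) = conv f (partial_deriv k g)"
proof (rule ext)
  fix x
  have "partial_deriv k (conv f g) x = (\<Sum>j\<in>UNIV. axis k 1 $ j * conv f (partial_deriv j g) x)"
    by (rule partial_deriv_eq[OF conv_has_derivative[OF assms]])
  also have "\<dots> = (\<Sum>j\<in>UNIV. if j = k then conv f (partial_deriv j g) x else 0)"
    by (rule sum.cong) (auto simp: axis_def)
  finally show "partial_deriv k (conv f g) x = conv f (partial_deriv k g) x" by simp
qed

text \<open>Derivatives fall on the kernel only, so the convolutions of the fixed \<open>f\<close>
  with smooth compactly supported kernels are closed under partial derivatives.\<close>

lemma smooth_fun_conv:
  fixes f g :: "real^'n::finite \<Rightarrow> real"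
  assumes "integrable lborel f" "smooth_fun g" "vanishes_beyond r g"
  shows "smooth_fun (conv f g)"
proof (rule smooth_fun_coinduct[where S="{conv f g |g. smooth_fun g \<and> vanishes_beyond r g}"])
  fix h x assume "h \<in> {conv f g |g. smooth_fun g \<and> vanishes_beyond r g}"
  then obtain g where g: "h = conv f g" "smooth_fun g" "vanishes_beyond r g" by blast
  show "h differentiable (at x)"
    using conv_has_derivative[OF assms(1) g(2,3)] by (auto simp: differentiable_def g(1))
  show "partial_deriv k h \<in> {conv f g |g. smooth_fun g \<and> vanishes_beyond r g}" for k
    unfolding g(1) conv_partial_deriv[OF assms(1) g(2,3)]
    using smooth_fun_partial_deriv[OF g(2)] partial_deriv_support[OF g(3)] by blast
qed (use assms in auto)

section \<open>Reflection, translation and integrals of derivatives\<close>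

lemma lborel_integral_reflect:
  fixes g :: "'a::euclidean_space \<Rightarrow> real"
  assumes [measurable]: "g \<in> borel_measurable borel"
  shows "(\<integral>y. g (x - y) \<partial>lborel) = (\<integral>y. g y \<partial>lborel)"
proof -
  have "lborel = distr lborel borel (\<lambda>y. x + (-1) *\<^sub>R y :: 'a)"
    using lborel_affine[of "-1" x] by (simp add: density_1)
  then have "(\<integral>y. g y \<partial>lborel) = (\<integral>y. g y \<partial>distr lborel borel (\<lambda>y. x - y))"
    by simp
  also have "\<dots> = (\<integral>y. g (x - y) \<partial>lborel)"
    by (subst integral_distr) auto
  finally show ?thesis ..
qed

lemma lborel_integral_shift:
  fixes g :: "'a::euclidean_space \<Rightarrow> real"
  assumes [measurable]: "g \<in> borel_measurable borel"
  shows "(\<integral>x. g (x - y) \<partial>lborel) = (\<integral>x. g x \<partial>lborel)"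
proof -
  have "(\<integral>x. g x \<partial>lborel) = (\<integral>x. g x \<partial>distr lborel borel ((+) (- y)))"
    by (simp add: lborel_distr_plus)
  also have "\<dots> = (\<integral>x. g (x - y) \<partial>lborel)"
    by (subst integral_distr) auto
  finally show ?thesis ..
qed

text \<open>Near the origin, convolving \<open>g\<close> with the indicator of a large ball gives the constant
  \<open>\<integral> g\<close>; differentiating this convolution is the integration by parts.\<close>
lemma integral_partial_deriv_eq_0:
  fixes g :: "real^'n::finite \<Rightarrow> real"
  assumes g: "smooth_fun g" "vanishes_beyond r g"
  shows "(\<integral>x. partial_deriv k g x \<partial>lborel) = 0"
proof -
  \<comment> \<open>The margin covers every \<open>x\<close> with \<open>norm x < 1\<close>: where
    \<open>norm (x - y) \<le> r\<close>, also \<open>norm y < r + 1\<close>.\<close>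
  let ?f = "indicator (ball 0 (r + 2)) :: real^'n \<Rightarrow> real"
  have f: "integrable lborel ?f"
    using emeasure_bounded_finite[OF bounded_ball] by (intro integrable_real_indicator) auto
  have eq: "conv ?f h x = (\<integral>y. h y \<partial>lborel)"
    if "vanishes_beyond r h" "h \<in> borel_measurable borel" "norm x < 1" for h x
  proof -
    have "?f y * h (x - y) = h (x - y)" for y
    proof (cases "norm (x - y) > r")
      case False
      have "norm (x - (x - y)) \<le> norm x + norm (x - y)"
        by (rule norm_triangle_ineq4)
      then have "y \<in> ball 0 (r + 2)" using False that(3) by simp
      then show ?thesis by simp
    qed (simp add: vanishes_beyondD[OF that(1)])
    then have "conv ?f h x = (\<integral>y. h (x - y) \<partial>lborel)"
      unfolding conv_def by (rule Bochner_Integration.integral_cong[OF refl])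
    then show ?thesis
      by (simp add: lborel_integral_reflect[OF that(2)])
  qed
  have "(\<integral>x. partial_deriv k g x \<partial>lborel) = conv ?f (partial_deriv k g) 0"
    by (intro eq[symmetric] partial_deriv_support smooth_fun_borel smooth_fun_partial_deriv g) simp
  also have "\<dots> = partial_deriv k (conv ?f g) 0"
    by (simp add: conv_partial_deriv[OF f g])
  also have "\<dots> = 0"
    by (rule partial_deriv_vanishes[of "ball 0 1"]) (use eq[OF g(2) smooth_fun_borel[OF g(1)]] in auto)
  finally show ?thesis .
qed

section \<open>Mollification\<close>

text \<open>Nonempty open sets are not null. This turns statements valid almost everywhere into
  actual points.\<close>

lemma AE_lborel_openD:
  fixes S :: "'a::euclidean_space set"
  assumes "AE x in lborel. x \<in> S \<longrightarrow> P x" "open S" "S \<noteq> {}"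
  obtains x where "x \<in> S" "P x"
proof -
  obtain y where y: "y \<in> S" using assms(3) by blast
  have "\<exists>x\<in>S. P x"
  proof (rule ccontr)
    assume n: "\<not> (\<exists>x\<in>S. P x)"
    have "AE x in lborel. x \<in> S \<longrightarrow> x \<in> {}"
      by (rule eventually_mono[OF assms(1)]) (use n in blast)
    then have "AE x in lebesgue. x \<in> S \<longrightarrow> x \<in> {}"
      by (simp only: AE_completion_iff)
    \<comment> \<open>With the closed set taken to be empty, an open set that is null would have all
      its points in the empty set.\<close>
    from mem_closed_if_AE_lebesgue_open[OF assms(2) closed_empty this y] show False by simp
  qed
  then show ?thesis using that by blast
qed

lemma bump_vanishes_beyond:
  fixes a :: "real^'n::finite"
  shows "r > 0 \<Longrightarrow> vanishes_beyond (norm a + r) (bump a r)"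
  unfolding vanishes_beyond_def
proof (intro allI impI)
  fix x :: "real^'n" assume "r > 0" "norm a + r < norm x"
  then have "dist x a \<ge> r"
    using norm_triangle_ineq2[of x a] by (simp add: dist_norm)
  with \<open>r > 0\<close> show "bump a r x = 0" by (rule bump_eq_0)
qed

lemma bump_integrable: "r > 0 \<Longrightarrow> integrable lborel (bump a r)"
  by (rule integrable_compact_support[OF smooth_fun_continuous_on bump_vanishes_beyond]) simp_all

lemma bump_integral_pos:
  assumes "r > 0" shows "(\<integral>x. bump a r x \<partial>lborel) > 0"
proof -
  have "(\<integral>x. bump a r x \<partial>lborel) \<noteq> 0"
  proof
    assume "(\<integral>x. bump a r x \<partial>lborel) = 0"
    then have "AE x in lborel. bump a r x = 0"
      using bump_integrable[OF assms] by (subst (asm) integral_nonneg_eq_0_iff_AE) auto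
    then have "AE x in lborel. x \<in> ball a r \<longrightarrow> bump a r x = 0" by (auto elim: eventually_mono)
    then obtain x where "x \<in> ball a r" "bump a r x = 0"
      by (rule AE_lborel_openD) (use assms in auto)
    then show False
      using bump_pos_iff[OF assms, of a x] by (simp add: dist_commute)
  qed
  moreover have "(\<integral>x. bump a r x \<partial>lborel) \<ge> 0" by simp
  ultimately show ?thesis by linarith
qed

section \<open>The normalised kernel and its averaging properties\<close>

definition mollifier :: "real \<Rightarrow> real^'n::finite \<Rightarrow> real" where
  "mollifier r x = inverse (\<integral>y. bump (0::real^'n) r y \<partial>lborel) * bump 0 r x"

lemma smooth_fun_mollifier [simp]: "smooth_fun (mollifier r)"
  unfolding mollifier_def[abs_def] by (intro smooth_intros smooth_fun_bump)

lemma continuous_on_mollifier: "continuous_on S (mollifier r)"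
  by (simp add: smooth_fun_continuous_on)

lemma mollifier_borel [measurable]: "mollifier r \<in> borel_measurable borel"
  by (simp add: smooth_fun_borel)

lemma mollifier_vanishes_beyond: "r > 0 \<Longrightarrow> vanishes_beyond r (mollifier r)"
  using bump_vanishes_beyond[of r 0] by (auto simp: vanishes_beyond_def mollifier_def)

lemma mollifier_nonneg: "r > 0 \<Longrightarrow> mollifier r x \<ge> 0"
  using bump_integral_pos[of r 0] by (simp add: mollifier_def)

lemma mollifier_integral:
  "r > 0 \<Longrightarrow> (\<integral>x. mollifier r (x :: real^'n::finite) \<partial>lborel) = 1"
  using bump_integral_pos[of r "0 :: real^'n"] by (simp add: mollifier_def[abs_def])

text \<open>The bump is even, so as a function of \<open>y\<close> the kernel at \<open>x\<close> is
  a multiple of the bump centred at \<open>x\<close>. Values of a mollified field are therefore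
  integrals of the field against bumps, which are admissible test functions.\<close>

lemma mollifier_reflect:
  "mollifier r (x - y) = inverse (\<integral>y. bump (0::real^'n::finite) r y \<partial>lborel) * bump x r (y :: real^'n)"
proof -
  have "(x - y) \<bullet> (x - y) = (y - x) \<bullet> (y - x)"
    by (simp add: algebra_simps)
  then show ?thesis by (simp add: mollifier_def bump_def)
qed

lemma mollifier_shift:
  "mollifier r (x - y) = inverse (\<integral>y. bump (0::real^'n::finite) r y \<partial>lborel) * bump y r (x :: real^'n)"
  by (simp add: mollifier_def bump_def)

lemma partial_deriv_mollifier_reflect:
  "partial_deriv k (mollifier r) (x - y) =
    - (inverse (\<integral>y. bump (0::real^'n::finite) r y \<partial>lborel) * partial_deriv k (bump x r) (y :: real^'n))"
proof -
  have "(x - y) \<bullet> (x - y) = (y - x) \<bullet> (y - x)"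
    by (simp add: algebra_simps)
  then have "partial_deriv k (bump 0 r) (x - y) = - partial_deriv k (bump x r) y"
    unfolding bump_def[abs_def] partial_deriv_profile by (simp add: algebra_simps)
  moreover have "partial_deriv k (mollifier r) z =
      inverse (\<integral>y. bump (0::real^'n) r y \<partial>lborel) * partial_deriv k (bump 0 r) z" for z
    unfolding mollifier_def[abs_def]
    by (subst partial_deriv_mult) (simp_all add: smooth_fun_differentiable)
  ultimately show ?thesis by simp
qed

lemma mollifier_shift_integrable:
  fixes x :: "real^'n::finite"
  assumes "r > 0" shows "integrable lborel (\<lambda>y. mollifier r (x - y))"
  unfolding mollifier_reflect by (intro integrable_mult_right bump_integrable assms)

lemma mollifier_shift_integral:
  fixes x :: "real^'n::finite"
  assumes "r > 0" shows "(\<integral>y. mollifier r (x - y) \<partial>lborel) = 1"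
  using lborel_integral_reflect[OF mollifier_borel, of r x] by (simp add: mollifier_integral[OF assms])

text \<open>The kernel is nonnegative with integral 1, so mollification is an average and preserves
  bounds.\<close>

lemma conv_mollifier_bound:
  fixes f :: "real^'n::finite \<Rightarrow> real"
  assumes f: "integrable lborel f" "\<And>x. \<bar>f x\<bar> \<le> M" and "r > 0"
  shows "\<bar>conv f (mollifier r) x\<bar> \<le> M"
proof -
  have i: "integrable lborel (\<lambda>y. f y * mollifier r (x - y))"
    by (rule conv_integrable[OF f(1) continuous_on_mollifier mollifier_vanishes_beyond[OF \<open>r > 0\<close>]])
  have "\<bar>conv f (mollifier r) x\<bar> \<le> (\<integral>y. \<bar>f y * mollifier r (x - y)\<bar> \<partial>lborel)"
    unfolding conv_def by (rule integral_abs_bound)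
  also have "\<dots> \<le> (\<integral>y. M * mollifier r (x - y) \<partial>lborel)"
  proof (rule integral_mono[OF integrable_abs[OF i]])
    show "integrable lborel (\<lambda>y. M * mollifier r (x - y))"
      by (intro integrable_mult_right mollifier_shift_integrable[OF \<open>r > 0\<close>])
    show "\<bar>f y * mollifier r (x - y)\<bar> \<le> M * mollifier r (x - y)" for y
      using f(2)[of y] mollifier_nonneg[OF \<open>r > 0\<close>, of "x - y"]
      by (simp add: abs_mult mult_right_mono)
  qed
  also have "\<dots> = M" by (simp add: mollifier_shift_integral[OF \<open>r > 0\<close>])
  finally show ?thesis .
qed

text \<open>Fubini for \<open>f y * mollifier r (x - y)\<close>: integrated over \<open>x\<close>
  first, each translate of the kernel contributes 1.\<close>

lemma conv_mollifier_L1: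
  fixes f :: "real^'n::finite \<Rightarrow> real"
  assumes f: "integrable lborel f" and "r > 0"
  shows "integrable lborel (conv f (mollifier r))"
    and "(\<integral>x. \<bar>conv f (mollifier r) x\<bar> \<partial>lborel) \<le> (\<integral>x. \<bar>f x\<bar> \<partial>lborel)"
proof -
  let ?m = "mollifier r :: real^'n \<Rightarrow> real"
  note nonneg = mollifier_nonneg[OF \<open>r > 0\<close>]
  have [measurable]: "f \<in> borel_measurable borel"
    using f by (simp add: borel_measurable_integrable)
  have shift: "(\<integral>x. ?m (x - y) \<partial>lborel) = 1" for y
    using lborel_integral_shift[OF mollifier_borel, of r y] by (simp add: mollifier_integral[OF \<open>r > 0\<close>])
  have ishift: "integrable lborel (\<lambda>x. ?m (x - y))" for y
    unfolding mollifier_shift by (intro integrable_mult_right bump_integrable \<open>r > 0\<close>)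
  have prod: "integrable (lborel \<Otimes>\<^sub>M lborel) (\<lambda>(y, x). f y * ?m (x - y))"
  proof (rule lborel_pair.Fubini_integrable)
    show "integrable lborel (\<lambda>y. \<integral>x. norm (case (y, x) of (y, x) \<Rightarrow> f y * ?m (x - y)) \<partial>lborel)"
      using f by (simp add: abs_mult nonneg shift)
  qed (auto simp: ishift)
  show "integrable lborel (conv f (mollifier r))"
    using lborel_pair.integrable_snd[OF prod] by (simp add: conv_def[abs_def])
  have aprod: "integrable (lborel \<Otimes>\<^sub>M lborel) (\<lambda>(y, x). \<bar>f y\<bar> * ?m (x - y))"
    using integrable_abs[OF prod] by (simp add: case_prod_beta' abs_mult nonneg)
  have "(\<integral>x. \<bar>conv f (mollifier r) x\<bar> \<partial>lborel) \<le> (\<integral>x. (\<integral>y. \<bar>f y\<bar> * ?m (x - y) \<partial>lborel) \<partial>lborel)"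
  proof (rule integral_mono)
    show "integrable lborel (\<lambda>x. \<bar>conv f (mollifier r) x\<bar>)"
      using \<open>integrable lborel (conv f (mollifier r))\<close> by simp
    show "integrable lborel (\<lambda>x. \<integral>y. \<bar>f y\<bar> * ?m (x - y) \<partial>lborel)"
      by (rule lborel_pair.integrable_snd[OF aprod])
    fix x
    have "\<bar>conv f (mollifier r) x\<bar> \<le> (\<integral>y. \<bar>f y * ?m (x - y)\<bar> \<partial>lborel)"
      unfolding conv_def by (rule integral_abs_bound)
    then show "\<bar>conv f (mollifier r) x\<bar> \<le> (\<integral>y. \<bar>f y\<bar> * ?m (x - y) \<partial>lborel)"
      by (simp add: abs_mult nonneg)
  qed
  also have "\<dots> = (\<integral>y. (\<integral>x. \<bar>f y\<bar> * ?m (x - y) \<partial>lborel) \<partial>lborel)"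
    by (rule lborel_pair.Fubini_integral[OF aprod])
  also have "\<dots> = (\<integral>x. \<bar>f x\<bar> \<partial>lborel)"
    by (simp add: shift)
  finally show "(\<integral>x. \<bar>conv f (mollifier r) x\<bar> \<partial>lborel) \<le> (\<integral>x. \<bar>f x\<bar> \<partial>lborel)" .
qed

text \<open>Measurability provides continuous functions converging to \<open>f\<close> almost
  everywhere. Truncating their values at \<open>M\<close> and multiplying by a cutoff makes
  dominated convergence applicable without changing the limit.\<close>

lemma L1_approx_continuous:
  fixes f :: "'a::euclidean_space \<Rightarrow> real"
  assumes [measurable]: "f \<in> borel_measurable borel" and f: "\<And>x. \<bar>f x\<bar> \<le> M" "vanishes_beyond r f"
    and "e > 0"
  obtains h where "continuous_on UNIV h" "vanishes_beyond (r + 1) h" "(\<integral>x. \<bar>f x - h x\<bar> \<partial>lborel) < e"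
proof -
  have M: "M \<ge> 0" using f(1)[of undefined] by linarith
  have "f \<in> borel_measurable lebesgue"
    by (intro measurable_completion) simp
  then have "f measurable_on UNIV"
    by (rule lebesgue_measurable_imp_measurable_on) simp
  then obtain N g where N: "negligible N" and g: "\<And>n. continuous_on UNIV (g n)"
    and lim: "\<And>x. x \<notin> N \<Longrightarrow> (\<lambda>n. g n x) \<longlonglongrightarrow> f x"
    unfolding measurable_on_def by auto
  \<comment> \<open>This cutoff is 1 up to radius \<open>r\<close>, zero beyond \<open>r + 1\<close>
    and continuous in between.\<close>
  define cut :: "'a \<Rightarrow> real" where "cut x = max 0 (min 1 (r + 1 - norm x))" for x
  define h where "h n x = max (- M) (min M (g n x)) * cut x" for n x
  have h_cont: "continuous_on UNIV (h n)" for n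
    unfolding h_def cut_def by (intro continuous_intros g)
  have h_supp: "vanishes_beyond (r + 1) (h n)" for n
    by (auto simp: vanishes_beyond_def h_def cut_def)
  have [measurable]: "h n \<in> borel_measurable borel" for n
    by (simp add: borel_measurable_continuous_onI h_cont)
  have h_bound: "\<bar>h n x\<bar> \<le> M" for n x
  proof -
    have "\<bar>max (- M) (min M (g n x))\<bar> * \<bar>cut x\<bar> \<le> M * 1"
      using M by (intro mult_mono) (auto simp: cut_def)
    then show ?thesis by (simp add: h_def abs_mult)
  qed
  have h_lim: "(\<lambda>n. h n x) \<longlonglongrightarrow> f x" if "x \<notin> N" for x
  proof -
    have "(\<lambda>n. h n x) \<longlonglongrightarrow> max (- M) (min M (f x)) * cut x"
      unfolding h_def by (intro tendsto_intros tendsto_max tendsto_min lim that)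
    moreover have "max (- M) (min M (f x)) * cut x = f x"
      using f(1)[of x] vanishes_beyondD[OF f(2), of x] by (cases "norm x \<le> r") (auto simp: cut_def)
    ultimately show ?thesis by simp
  qed
  have "(\<lambda>n. \<integral>x. \<bar>f x - h n x\<bar> \<partial>lborel) \<longlonglongrightarrow> (\<integral>x. 0 \<partial>(lborel :: 'a measure))"
  proof (rule integral_dominated_convergence[where w="\<lambda>x. 2 * M * indicator (cball 0 (r + 1)) x"])
    show "integrable lborel (\<lambda>x::'a. 2 * M * indicator (cball 0 (r + 1)) x)"
      using emeasure_bounded_finite[OF bounded_cball]
      by (intro integrable_mult_right integrable_real_indicator) auto
    have "AE x in lebesgue. x \<notin> N"
      using N by (intro AE_not_in) (simp add: negligible_iff_null_sets)
    then have "AE x in lborel. x \<notin> N"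
      by (simp only: AE_completion_iff)
    then show "AE x in lborel. (\<lambda>n. \<bar>f x - h n x\<bar>) \<longlonglongrightarrow> 0"
    proof (rule eventually_mono)
      fix x assume "x \<notin> N"
      from tendsto_rabs[OF tendsto_diff[OF tendsto_const[of "f x"] h_lim[OF this]]]
      show "(\<lambda>n. \<bar>f x - h n x\<bar>) \<longlonglongrightarrow> 0" by simp
    qed
    show "AE x in lborel. norm \<bar>f x - h n x\<bar> \<le> 2 * M * indicator (cball 0 (r + 1)) x" for n
    proof (rule AE_I2)
      fix x
      show "norm \<bar>f x - h n x\<bar> \<le> 2 * M * indicator (cball 0 (r + 1)) x"
      proof (cases "norm x \<le> r + 1")
        case True
        then show ?thesis using f(1)[of x] h_bound[of n x] by simp
      next
        case False
        then show ?thesis using vanishes_beyondD[OF f(2), of x] vanishes_beyondD[OF h_supp, of x n] by simp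
      qed
    qed
  qed simp_all
  then have "(\<lambda>n. \<integral>x. \<bar>f x - h n x\<bar> \<partial>lborel) \<longlonglongrightarrow> 0" by simp
  then have "\<forall>\<^sub>F n in sequentially. (\<integral>x. \<bar>f x - h n x\<bar> \<partial>lborel) < e"
    using \<open>e > 0\<close> by (rule order_tendstoD(2))
  then obtain n where "(\<integral>x. \<bar>f x - h n x\<bar> \<partial>lborel) < e"
    by (auto simp: eventually_sequentially)
  then show ?thesis using that[OF h_cont h_supp] by blast
qed

text \<open>The error at \<open>x\<close> is the kernel average of \<open>h y - h x\<close>, and the
  kernel only sees points \<open>y\<close> within \<open>r\<close> of \<open>x\<close>.\<close>

lemma conv_mollifier_uniform:
  fixes h :: "real^'n::finite \<Rightarrow> real"
  assumes h: "integrable lborel h" and "r > 0" and d: "\<And>x y. dist y x \<le> r \<Longrightarrow> dist (h y) (h x) \<le> e"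
  shows "\<bar>conv h (mollifier r) x - h x\<bar> \<le> e"
proof -
  let ?m = "\<lambda>y. mollifier r (x - y)"
  note nonneg = mollifier_nonneg[OF \<open>r > 0\<close>]
  have i: "integrable lborel (\<lambda>y. h y * ?m y)"
    by (rule conv_integrable[OF h continuous_on_mollifier mollifier_vanishes_beyond[OF \<open>r > 0\<close>]])
  have im: "integrable lborel ?m" by (rule mollifier_shift_integrable[OF \<open>r > 0\<close>])
  have i': "integrable lborel (\<lambda>y. (h y - h x) * ?m y)"
    using Bochner_Integration.integrable_diff[OF i integrable_mult_right[of "h x", OF im]]
    by (simp add: left_diff_distrib)
  have "conv h (mollifier r) x - h x = (\<integral>y. (h y - h x) * ?m y \<partial>lborel)"
    unfolding conv_def left_diff_distrib
    by (subst Bochner_Integration.integral_diff)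
      (use i im in \<open>simp_all add: mollifier_shift_integral[OF \<open>r > 0\<close>]\<close>)
  also have "\<bar>\<dots>\<bar> \<le> (\<integral>y. \<bar>(h y - h x) * ?m y\<bar> \<partial>lborel)"
    by (rule integral_abs_bound)
  also have "\<dots> \<le> (\<integral>y. e * ?m y \<partial>lborel)"
  proof (rule integral_mono)
    fix y
    show "\<bar>(h y - h x) * ?m y\<bar> \<le> e * ?m y"
    proof (cases "dist y x \<le> r")
      case True
      then show ?thesis
        using d[OF True] nonneg[of "x - y"] by (auto simp: abs_mult dist_norm intro!: mult_right_mono)
    next
      case False
      then have "?m y = 0"
        using vanishes_beyondD[OF mollifier_vanishes_beyond[OF \<open>r > 0\<close>], of "x - y"]
        by (simp add: dist_norm norm_minus_commute)
      then show ?thesis by simp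
    qed
  qed (use integrable_abs[OF i'] im in simp_all)
  also have "\<dots> = e" by (simp add: mollifier_shift_integral[OF \<open>r > 0\<close>])
  finally show ?thesis .
qed

section \<open>Convergence of mollifications\<close>

definition mollify :: "nat \<Rightarrow> (real^'n::finite \<Rightarrow> real) \<Rightarrow> real^'n \<Rightarrow> real" where
  "mollify n f = conv f (mollifier (1 / real (Suc n)))"

text \<open>A continuous \<open>h\<close> close to \<open>f\<close> splits the error into three
  parts. Replacing \<open>f\<close> by \<open>h\<close> costs at most \<open>e / 3\<close>, before
  and after mollification, since the latter does not increase the L1 norm; the error of
  \<open>h\<close> itself is uniformly small and confined to a fixed ball.\<close>

lemma mollify_tendsto_L1:
  fixes f :: "real^'n::finite \<Rightarrow> real"
  assumes f: "f \<in> borel_measurable borel" "\<And>x. \<bar>f x\<bar> \<le> M" "vanishes_beyond r f"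
  shows "(\<lambda>n. \<integral>x. \<bar>mollify n f x - f x\<bar> \<partial>lborel) \<longlonglongrightarrow> 0"
proof (rule LIMSEQ_I)
  fix e :: real assume "e > 0"
  have fi: "integrable lborel f" by (rule integrable_bounded_support[OF f])
  obtain h where h: "continuous_on UNIV h" "vanishes_beyond (r + 1) h"
    and fh: "(\<integral>x. \<bar>f x - h x\<bar> \<partial>lborel) < e / 3"
    using L1_approx_continuous[OF f, of "e / 3"] \<open>e > 0\<close> by auto
  have hi: "integrable lborel h" by (rule integrable_compact_support[OF h])
  \<comment> \<open>Since \<open>h\<close> vanishes beyond \<open>r + 1\<close> and the kernel
    radius is at most 1, the error of \<open>h\<close> lives in the ball of radius
    \<open>r + 2\<close>. The choice of \<open>e'\<close> makes
    \<open>e' * B \<le> e / 3\<close>.\<close>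
  define B where "B = measure lborel (cball (0::real^'n) (r + 2))"
  define e' where "e' = e / (3 * (B + 1))"
  have B: "B \<ge> 0" by (simp add: B_def)
  have e': "e' > 0" using B \<open>e > 0\<close> by (simp add: e'_def)
  obtain d where d: "d > 0" "\<And>x y. dist y x < d \<Longrightarrow> dist (h y) (h x) < e'"
    using compact_support_uniformly_continuous[OF h] e' unfolding uniformly_continuous_on_def by blast
  obtain N where N: "1 / real (Suc N) < d"
    using \<open>d > 0\<close> nat_approx_posE by blast
  have "norm ((\<integral>x. \<bar>mollify n f x - f x\<bar> \<partial>lborel) - 0) < e" if "n \<ge> N" for n
  proof -
    define s where "s = 1 / real (Suc n)"
    have "s \<le> 1 / real (Suc N)"
      unfolding s_def using that by (intro divide_left_mono) auto
    then have s: "s > 0" "s < d" "s \<le> 1" using N by (auto simp: s_def)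
    let ?m = "mollifier s :: real^'n \<Rightarrow> real"
    have fhi: "integrable lborel (\<lambda>x. f x - h x)" using fi hi by simp
    have ind: "integrable lborel (\<lambda>x. e' * indicator (cball (0::real^'n) (r + 2)) x)"
      using emeasure_bounded_finite[OF bounded_cball]
      by (intro integrable_mult_right integrable_real_indicator) auto
    note mi = conv_integrable[OF _ continuous_on_mollifier mollifier_vanishes_beyond[OF s(1)]]
    have split: "conv f ?m x = conv (\<lambda>x. f x - h x) ?m x + conv h ?m x" for x
      unfolding conv_def left_diff_distrib using mi[OF fi, of x] mi[OF hi, of x] by simp
    have "(\<integral>x. \<bar>conv f ?m x - f x\<bar> \<partial>lborel) \<le>
      (\<integral>x. \<bar>conv (\<lambda>x. f x - h x) ?m x\<bar> + e' * indicator (cball 0 (r + 2)) x + \<bar>f x - h x\<bar> \<partial>lborel)"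
    proof (rule integral_mono)
      show "integrable lborel (\<lambda>x. \<bar>conv f ?m x - f x\<bar>)"
        using fi conv_mollifier_L1(1)[OF fi s(1)] by simp
      show "integrable lborel (\<lambda>x. \<bar>conv (\<lambda>x. f x - h x) ?m x\<bar> + e' * indicator (cball 0 (r + 2)) x + \<bar>f x - h x\<bar>)"
        using fhi conv_mollifier_L1(1)[OF fhi s(1)] ind
        by (intro Bochner_Integration.integrable_add) auto
      fix x :: "real^'n"
      have "\<bar>conv h ?m x - h x\<bar> \<le> e' * indicator (cball 0 (r + 2)) x"
      proof (cases "norm x \<le> r + 2")
        case True
        have "\<bar>conv h ?m x - h x\<bar> \<le> e'"
          by (rule conv_mollifier_uniform[OF hi s(1)]) (use d(2) s(2) in \<open>meson le_less_trans less_imp_le\<close>)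
        then show ?thesis using True by simp
      next
        case False
        have "h y * ?m (x - y) = 0" for y
        proof (cases "norm y > r + 1")
          case False': False
          have "norm (x - y) > s"
            using False False' s(3) norm_triangle_ineq2[of x y] by linarith
          then show ?thesis
            using vanishes_beyondD[OF mollifier_vanishes_beyond[OF s(1)], of "x - y"] by simp
        qed (simp add: vanishes_beyondD[OF h(2)])
        then have "conv h ?m x = 0"
          unfolding conv_def by (simp only: Bochner_Integration.integral_zero)
        then show ?thesis using False vanishes_beyondD[OF h(2), of x] by simp
      qed
      then show "\<bar>conv f ?m x - f x\<bar> \<le>
          \<bar>conv (\<lambda>x. f x - h x) ?m x\<bar> + e' * indicator (cball 0 (r + 2)) x + \<bar>f x - h x\<bar>"
        unfolding split by linarith
    qed
    also have "\<dots> = (\<integral>x. \<bar>conv (\<lambda>x. f x - h x) ?m x\<bar> \<partial>lborel) + e' * B + (\<integral>x. \<bar>f x - h x\<bar> \<partial>lborel)"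
      using fhi conv_mollifier_L1(1)[OF fhi s(1)] ind
      by (subst Bochner_Integration.integral_add, simp, simp, subst Bochner_Integration.integral_add)
        (auto simp: B_def)
    also have "\<dots> < e / 3 + e / 3 + e / 3"
    proof -
      have "e' * B \<le> e / 3" using B \<open>e > 0\<close> by (simp add: e'_def field_simps)
      then show ?thesis using fh conv_mollifier_L1(2)[OF fhi s(1)] by linarith
    qed
    finally have "(\<integral>x. \<bar>mollify n f x - f x\<bar> \<partial>lborel) < e"
      by (simp add: mollify_def s_def)
    then show ?thesis by simp
  qed
  then show "\<exists>N. \<forall>n\<ge>N. norm ((\<integral>x. \<bar>mollify n f x - f x\<bar> \<partial>lborel) - 0) < e" by blast
qed

text \<open>Adding up the errors of the finitely many functions gives one sequence tending to zero
  in L1, hence one subsequence that works for all of them at once.\<close>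

lemma mollify_AE_subseq:
  fixes f :: "'i::finite \<Rightarrow> real^'n::finite \<Rightarrow> real"
  assumes f: "\<And>i. f i \<in> borel_measurable borel" "\<And>i x. \<bar>f i x\<bar> \<le> M" "\<And>i. vanishes_beyond r (f i)"
  obtains s :: "nat \<Rightarrow> nat" where "strict_mono s"
    "AE x in lborel. \<forall>i. (\<lambda>n. mollify (s n) (f i) x) \<longlonglongrightarrow> f i x"
proof -
  have fi: "integrable lborel (f i)" for i by (rule integrable_bounded_support[OF f])
  have mi: "integrable lborel (\<lambda>x. \<bar>mollify n (f i) x - f i x\<bar>)" for n i
    unfolding mollify_def using conv_mollifier_L1(1)[OF fi] fi by simp
  define u where "u n x = (\<Sum>i\<in>UNIV. \<bar>mollify n (f i) x - f i x\<bar>)" for n x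
  have u0: "u n x \<ge> 0" for n x by (simp add: u_def sum_nonneg)
  have "(\<lambda>n. \<Sum>i\<in>UNIV. \<integral>x. \<bar>mollify n (f i) x - f i x\<bar> \<partial>lborel) \<longlonglongrightarrow> (\<Sum>i\<in>(UNIV::'i set). 0)"
    by (intro tendsto_sum mollify_tendsto_L1[OF f])
  then have "(\<lambda>n. \<integral>x. norm (u n x) \<partial>lborel) \<longlonglongrightarrow> 0"
    using u0 by (simp add: u_def Bochner_Integration.integral_sum mi)
  moreover have "integrable lborel (u n)" for n
    unfolding u_def[abs_def] by (intro Bochner_Integration.integrable_sum mi)
  ultimately obtain s :: "nat \<Rightarrow> nat" where s: "strict_mono s" "AE x in lborel. (\<lambda>n. u (s n) x) \<longlonglongrightarrow> 0"
    using tendsto_L1_AE_subseq[of lborel u] by blast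
  from s(2) have "AE x in lborel. \<forall>i. (\<lambda>n. mollify (s n) (f i) x) \<longlonglongrightarrow> f i x"
  proof (rule eventually_mono, intro allI)
    fix x i assume lim: "(\<lambda>n. u (s n) x) \<longlonglongrightarrow> 0"
    have "(\<lambda>n. mollify (s n) (f i) x - f i x) \<longlonglongrightarrow> 0"
    proof (rule Lim_null_comparison[OF _ lim])
      have "norm (mollify (s n) (f i) x - f i x) \<le> u (s n) x" for n
        unfolding u_def real_norm_def by (rule member_le_sum) auto
      then show "\<forall>\<^sub>F n in sequentially. norm (mollify (s n) (f i) x - f i x) \<le> u (s n) x" by simp
    qed
    then show "(\<lambda>n. mollify (s n) (f i) x) \<longlonglongrightarrow> f i x" by (simp add: LIM_zero_iff)
  qed
  with s(1) show ?thesis using that by blast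
qed

section \<open>Integral identities for smooth fields\<close>

lemma vanishes_beyond_mult: "vanishes_beyond r f \<Longrightarrow> vanishes_beyond r (\<lambda>x. f x * g x)"
  by (simp add: vanishes_beyond_def)

lemma vanishes_beyond_add:
  "vanishes_beyond r f \<Longrightarrow> vanishes_beyond r g \<Longrightarrow> vanishes_beyond r (\<lambda>x. f x + g x)"
  by (simp add: vanishes_beyond_def)

lemma integral_divergence_eq_0:
  fixes X :: "'n::finite \<Rightarrow> real^'n \<Rightarrow> real"
  assumes "\<And>j. smooth_fun (X j)" "\<And>j. vanishes_beyond r (X j)"
  shows "(\<integral>x. (\<Sum>j\<in>UNIV. partial_deriv j (X j) x) \<partial>lborel) = 0"
    and "integrable lborel (\<lambda>x. \<Sum>j\<in>UNIV. partial_deriv j (X j) x)"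
proof -
  have i: "integrable lborel (partial_deriv j (X j))" for j
    using assms by (intro integrable_compact_support[where r=r] smooth_fun_continuous_on
        smooth_fun_partial_deriv partial_deriv_support)
  show "(\<integral>x. (\<Sum>j\<in>UNIV. partial_deriv j (X j) x) \<partial>lborel) = 0"
    using integral_partial_deriv_eq_0[OF assms] by (simp add: Bochner_Integration.integral_sum i)
  show "integrable lborel (\<lambda>x. \<Sum>j\<in>UNIV. partial_deriv j (X j) x)"
    by (intro Bochner_Integration.integrable_sum i)
qed

lemmas partial_deriv_smooth_simps = partial_deriv_add partial_deriv_mult partial_deriv_diff
  smooth_fun_differentiable smooth_intros

lemma integral_by_parts:
  fixes \<phi> v :: "real^'n::finite \<Rightarrow> real"
  assumes \<phi>: "smooth_fun \<phi>" "vanishes_beyond r \<phi>" and v: "smooth_fun v"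
  shows "(\<integral>x. v x * partial_deriv k \<phi> x \<partial>lborel) = - (\<integral>x. \<phi> x * partial_deriv k v x \<partial>lborel)"
proof -
  have 1: "integrable lborel (\<lambda>x. v x * partial_deriv k \<phi> x)"
    using vanishes_beyond_mult[OF partial_deriv_support[OF \<phi>(2)], of k v] \<phi>(1) v
    by (intro integrable_compact_support[where r=r] smooth_fun_continuous_on smooth_intros)
      (simp_all add: mult.commute)
  have 2: "integrable lborel (\<lambda>x. \<phi> x * partial_deriv k v x)"
    using \<phi>(1) v
    by (intro integrable_compact_support[where r=r] smooth_fun_continuous_on smooth_intros
        vanishes_beyond_mult \<phi>(2))
  have "(\<integral>x. partial_deriv k (\<lambda>x. \<phi> x * v x) x \<partial>lborel) = 0"
    by (intro integral_partial_deriv_eq_0[where r=r] smooth_intros vanishes_beyond_mult \<phi> v)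
  then have "(\<integral>x. v x * partial_deriv k \<phi> x + \<phi> x * partial_deriv k v x \<partial>lborel) = 0"
    using \<phi>(1) v by (simp add: partial_deriv_smooth_simps mult.commute)
  then show ?thesis
    using 1 2 by simp
qed

text \<open>The integrand is the divergence of \<open>\<phi> (u \<times> w)\<close>, expanded with
  \<open>div (u \<times> w) = w \<cdot> curl u - u \<cdot> curl w\<close>. Applied to two rows, it
  gives access to the divergence of the third.\<close>

lemma integral_cross_eq_0:
  fixes u w :: "3 \<Rightarrow> real^3 \<Rightarrow> real"
  assumes \<phi>: "smooth_fun \<phi>" "vanishes_beyond r \<phi>"
    and u: "\<And>k. smooth_fun (u k)" and w: "\<And>k. smooth_fun (w k)"
  shows "(\<integral>x. partial_deriv 1 \<phi> x * (u 2 x * w 3 x - u 3 x * w 2 x)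
    + partial_deriv 2 \<phi> x * (u 3 x * w 1 x - u 1 x * w 3 x)
    + partial_deriv 3 \<phi> x * (u 1 x * w 2 x - u 2 x * w 1 x)
    + \<phi> x * (w 1 x * (partial_deriv 2 (u 3) x - partial_deriv 3 (u 2) x)
      + w 2 x * (partial_deriv 3 (u 1) x - partial_deriv 1 (u 3) x)
      + w 3 x * (partial_deriv 1 (u 2) x - partial_deriv 2 (u 1) x)
      - u 1 x * (partial_deriv 2 (w 3) x - partial_deriv 3 (w 2) x)
      - u 2 x * (partial_deriv 3 (w 1) x - partial_deriv 1 (w 3) x)
      - u 3 x * (partial_deriv 1 (w 2) x - partial_deriv 2 (w 1) x)) \<partial>lborel) = 0"
proof -
  define X :: "3 \<Rightarrow> real^3 \<Rightarrow> real" where "X j = (\<lambda>x. \<phi> x * (if j = 1 then u 2 x * w 3 x - u 3 x * w 2 x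
    else if j = 2 then u 3 x * w 1 x - u 1 x * w 3 x else u 1 x * w 2 x - u 2 x * w 1 x))" for j
  have X: "X 1 = (\<lambda>x. \<phi> x * (u 2 x * w 3 x - u 3 x * w 2 x))"
    "X 2 = (\<lambda>x. \<phi> x * (u 3 x * w 1 x - u 1 x * w 3 x))"
    "X 3 = (\<lambda>x. \<phi> x * (u 1 x * w 2 x - u 2 x * w 1 x))"
    by (simp_all add: X_def)
  have "smooth_fun (X j)" for j
    unfolding X_def using exhaust_3[of j] \<phi>(1) u w by (auto intro!: smooth_intros)
  moreover have "vanishes_beyond r (X j)" for j
    unfolding X_def by (rule vanishes_beyond_mult[OF \<phi>(2)])
  ultimately have "(\<integral>x. (\<Sum>j\<in>UNIV. partial_deriv j (X j) x) \<partial>lborel) = 0"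
    by (rule integral_divergence_eq_0)
  then show ?thesis
    unfolding sum_3 X by (simp add: partial_deriv_smooth_simps \<phi>(1) u w algebra_simps)
qed

text \<open>\<open>(div v)\<^sup>2 - tr (\<nabla>v)\<^sup>2\<close> is the divergence of \<open>v div v - (v \<cdot> \<nabla>) v\<close>, and
  \<open>(v \<cdot> \<nabla>) v = \<nabla>|v|\<^sup>2 / 2 - v \<times> curl v\<close>; this removes all derivatives of \<open>v\<close> except divergence and curl
  from the terms containing \<open>\<nabla>\<phi>\<close>.\<close>
lemma integral_div_curl_identity:
  fixes v :: "3 \<Rightarrow> real^3 \<Rightarrow> real"
  assumes \<phi>: "smooth_fun \<phi>" "vanishes_beyond r \<phi>"
    and v: "\<And>k. smooth_fun (v k)"
    and sym: "\<And>i j k. partial_deriv i (partial_deriv j (v k)) = partial_deriv j (partial_deriv i (v k))"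
  defines "A \<equiv> \<lambda>j k. partial_deriv j (v k)" and "p \<equiv> \<lambda>j. partial_deriv j \<phi>"
  defines "I \<equiv> \<lambda>x. \<phi> x * ((A 1 1 x + A 2 2 x + A 3 3 x)\<^sup>2 - (A 1 1 x)\<^sup>2 - (A 2 2 x)\<^sup>2 - (A 3 3 x)\<^sup>2
        - 2 * A 1 2 x * A 2 1 x - 2 * A 2 3 x * A 3 2 x - 2 * A 3 1 x * A 1 3 x)
      + (p 1 x * v 1 x + p 2 x * v 2 x + p 3 x * v 3 x) * (A 1 1 x + A 2 2 x + A 3 3 x)
      + (p 2 x * v 3 x - p 3 x * v 2 x) * (A 2 3 x - A 3 2 x)
      + (p 3 x * v 1 x - p 1 x * v 3 x) * (A 3 1 x - A 1 3 x)
      + (p 1 x * v 2 x - p 2 x * v 1 x) * (A 1 2 x - A 2 1 x)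
      + 1 / 2 * (partial_deriv 1 (p 1) x + partial_deriv 2 (p 2) x + partial_deriv 3 (p 3) x)
        * ((v 1 x)\<^sup>2 + (v 2 x)\<^sup>2 + (v 3 x)\<^sup>2)"
  shows "(\<integral>x. I x \<partial>lborel) = 0" and "integrable lborel I"
proof -
  \<comment> \<open>The value of \<open>c\<close> stays opaque while the derivatives of
    \<open>X\<close> are expanded and is restored for the final algebra.\<close>
  obtain c :: real where c: "c = 1 / 2" by blast
  define X where "X j = (\<lambda>x. \<phi> x * (v j x * (A 1 1 x + A 2 2 x + A 3 3 x)
      - (v 1 x * A 1 j x + v 2 x * A 2 j x + v 3 x * A 3 j x))
    + p j x * (c * (v 1 x * v 1 x + v 2 x * v 2 x + v 3 x * v 3 x)))" for j
  have A: "smooth_fun (A j k)" for j k unfolding A_def by (intro smooth_intros v)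
  have p: "smooth_fun (p j)" for j unfolding p_def by (intro smooth_intros \<phi>(1))
  have "smooth_fun (X j)" for j
    unfolding X_def by (intro smooth_intros \<phi>(1) v A p)
  moreover have "vanishes_beyond r (X j)" for j
    unfolding X_def p_def
    by (intro vanishes_beyond_add vanishes_beyond_mult \<phi>(2) partial_deriv_support)
  ultimately have *: "(\<integral>x. (\<Sum>j\<in>UNIV. partial_deriv j (X j) x) \<partial>lborel) = 0"
    "integrable lborel (\<lambda>x. \<Sum>j\<in>UNIV. partial_deriv j (X j) x)"
    using integral_divergence_eq_0[of X r] by blast+
  have v': "partial_deriv j (v k) = A j k" and p': "partial_deriv j \<phi> = p j" for j k
    by (simp_all add: A_def p_def)
  \<comment> \<open>Once mixed derivatives are put in one order, the second derivatives of
    \<open>v\<close> cancel in the sum over \<open>j\<close>.\<close>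
  have sym': "partial_deriv 2 (A 1 k) = partial_deriv 1 (A 2 k)"
    "partial_deriv 3 (A 1 k) = partial_deriv 1 (A 3 k)"
    "partial_deriv 3 (A 2 k) = partial_deriv 2 (A 3 k)" for k
    unfolding A_def by (rule sym)+
  have X': "partial_deriv j (X j) x = p j x * (v j x * (A 1 1 x + A 2 2 x + A 3 3 x)
      - (v 1 x * A 1 j x + v 2 x * A 2 j x + v 3 x * A 3 j x))
    + \<phi> x * (A j j x * (A 1 1 x + A 2 2 x + A 3 3 x)
      + v j x * (partial_deriv j (A 1 1) x + partial_deriv j (A 2 2) x + partial_deriv j (A 3 3) x)
      - (A j 1 x * A 1 j x + v 1 x * partial_deriv j (A 1 j) x + (A j 2 x * A 2 j x
        + v 2 x * partial_deriv j (A 2 j) x) + (A j 3 x * A 3 j x + v 3 x * partial_deriv j (A 3 j) x)))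
    + (partial_deriv j (p j) x * (c * (v 1 x * v 1 x + v 2 x * v 2 x + v 3 x * v 3 x))
    + p j x * (c * (A j 1 x * v 1 x + v 1 x * A j 1 x + (A j 2 x * v 2 x + v 2 x * A j 2 x)
      + (A j 3 x * v 3 x + v 3 x * A j 3 x))))" for j x
    unfolding X_def by (simp add: partial_deriv_smooth_simps \<phi>(1) v A p v' p')
  have "(\<Sum>j\<in>UNIV. partial_deriv j (X j) x) = I x" for x
    unfolding sum_3 X' sym' I_def c by algebra
  then show "(\<integral>x. I x \<partial>lborel) = 0" and "integrable lborel I"
    using * by simp_all
qed

text \<open>A matrix splits orthogonally into its trace part, its skew part and its trace-free
  symmetric part. The left side collects the first two; the squares in the proof are the
  third.\<close>

lemma gradient_ge_div_curl:
  fixes a11 a12 a13 a21 a22 a23 a31 a32 a33 :: real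
  shows "1 / 3 * (a11 + a22 + a33)\<^sup>2 + 1 / 2 * ((a23 - a32)\<^sup>2 + (a31 - a13)\<^sup>2 + (a12 - a21)\<^sup>2)
    \<le> a11\<^sup>2 + a12\<^sup>2 + a13\<^sup>2 + a21\<^sup>2 + a22\<^sup>2 + a23\<^sup>2 + a31\<^sup>2 + a32\<^sup>2 + a33\<^sup>2"
proof -
  have "0 \<le> 1 / 3 * ((a11 - a22)\<^sup>2 + (a22 - a33)\<^sup>2 + (a33 - a11)\<^sup>2)
      + 1 / 2 * ((a23 + a32)\<^sup>2 + (a31 + a13)\<^sup>2 + (a12 + a21)\<^sup>2)"
    by simp
  then show ?thesis by (simp add: power2_eq_square algebra_simps)
qed

section \<open>Algebra of rotation matrices\<close>

text \<open>These are the even permutations, for which row \<open>i\<close> of a rotation is the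
  cross product of rows \<open>j\<close> and \<open>k\<close>; one statement thus covers three
  rows.\<close>

definition cyclic3 :: "3 \<Rightarrow> 3 \<Rightarrow> 3 \<Rightarrow> bool" where
  "cyclic3 i j k \<longleftrightarrow> (i, j, k) \<in> {(1, 2, 3), (2, 3, 1), (3, 1, 2)}"

lemma cyclic3_simps [simp]: "cyclic3 1 2 3" "cyclic3 2 3 1" "cyclic3 3 1 2"
  by (simp_all add: cyclic3_def)

lemma cyclic3_cases:
  assumes "cyclic3 i j k"
  obtains "i = 1" "j = 2" "k = 3" | "i = 2" "j = 3" "k = 1" | "i = 3" "j = 1" "k = 2"
  using assms by (auto simp: cyclic3_def)

lemma cyclic3_exists: obtains j k where "cyclic3 i j k"
  using exhaust_3[of i] cyclic3_simps by metis

lemma SO3_rows_cols: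
  assumes "M \<in> SO3"
  shows "M$i$1 * M$j$1 + M$i$2 * M$j$2 + M$i$3 * M$j$3 = (if i = j then 1 else 0)"
    and "M$1$i * M$1$j + M$2$i * M$2$j + M$3$i * M$3$j = (if i = j then 1 else 0)"
proof -
  have c: "transpose M ** M = mat 1" using assms by (simp add: SO3_def)
  then have r: "M ** transpose M = mat 1" by (simp add: matrix_left_right_inverse)
  from r have "(M ** transpose M) $ i $ j = (if i = j then 1 else 0)" by (simp add: mat_def)
  then show "M$i$1 * M$j$1 + M$i$2 * M$j$2 + M$i$3 * M$j$3 = (if i = j then 1 else 0)"
    by (simp add: matrix_matrix_mult_def transpose_def sum_3)
  from c have "(transpose M ** M) $ i $ j = (if i = j then 1 else 0)" by (simp add: mat_def)
  then show "M$1$i * M$1$j + M$2$i * M$2$j + M$3$i * M$3$j = (if i = j then 1 else 0)"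
    by (simp add: matrix_matrix_mult_def transpose_def sum_3)
qed

text \<open>Rows \<open>p\<close> and \<open>q\<close> are orthonormal, so their cross product has
  length 1, and its inner product with row \<open>i\<close> is \<open>det M = 1\<close>. The squared
  distance between the two vectors is therefore \<open>1 - 2 + 1 = 0\<close>.\<close>

lemma SO3_cofactor:
  assumes "M \<in> SO3" "cyclic3 i p q"
  shows "M$i$1 = M$p$2 * M$q$3 - M$p$3 * M$q$2"
    and "M$i$2 = M$p$3 * M$q$1 - M$p$1 * M$q$3"
    and "M$i$3 = M$p$1 * M$q$2 - M$p$2 * M$q$1"
proof -
  note r = SO3_rows_cols(1)[OF assms(1)]
  have "p \<noteq> q" using assms(2) by (cases rule: cyclic3_cases) auto
  then have rr: "M$i$1 * M$i$1 + M$i$2 * M$i$2 + M$i$3 * M$i$3 = 1"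
    "M$p$1 * M$p$1 + M$p$2 * M$p$2 + M$p$3 * M$p$3 = 1"
    "M$q$1 * M$q$1 + M$q$2 * M$q$2 + M$q$3 * M$q$3 = 1"
    "M$p$1 * M$q$1 + M$p$2 * M$q$2 + M$p$3 * M$q$3 = 0"
    by (simp_all add: r)
  have "det M = 1" using assms(1) by (simp add: SO3_def)
  with assms(2) have d: "M$i$1 * (M$p$2 * M$q$3 - M$p$3 * M$q$2) + M$i$2 * (M$p$3 * M$q$1 - M$p$1 * M$q$3)
      + M$i$3 * (M$p$1 * M$q$2 - M$p$2 * M$q$1) = 1"
    by (cases rule: cyclic3_cases) (simp_all add: det_3 algebra_simps)
  have "(M$i$1 - (M$p$2 * M$q$3 - M$p$3 * M$q$2))\<^sup>2 + (M$i$2 - (M$p$3 * M$q$1 - M$p$1 * M$q$3))\<^sup>2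
      + (M$i$3 - (M$p$1 * M$q$2 - M$p$2 * M$q$1))\<^sup>2 = 0"
    using d rr by algebra
  then have "(M$i$1 - (M$p$2 * M$q$3 - M$p$3 * M$q$2))\<^sup>2 = 0"
    "(M$i$2 - (M$p$3 * M$q$1 - M$p$1 * M$q$3))\<^sup>2 = 0"
    "(M$i$3 - (M$p$1 * M$q$2 - M$p$2 * M$q$1))\<^sup>2 = 0"
    by (smt (verit) zero_le_power2)+
  then show "M$i$1 = M$p$2 * M$q$3 - M$p$3 * M$q$2"
    "M$i$2 = M$p$3 * M$q$1 - M$p$1 * M$q$3"
    "M$i$3 = M$p$1 * M$q$2 - M$p$2 * M$q$1"
    by simp_all
qed

lemma SO3_bound:
  assumes "M \<in> SO3" shows "\<bar>M$i$l\<bar> \<le> 1"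
proof -
  have "(M$i$1)\<^sup>2 + (M$i$2)\<^sup>2 + (M$i$3)\<^sup>2 = 1"
    using SO3_rows_cols(1)[OF assms, of i i] by (simp add: power2_eq_square)
  then have "(M$i$l)\<^sup>2 \<le> 1"
    using exhaust_3[of l] by (smt (verit) zero_le_power2)
  then show ?thesis by (simp add: abs_square_le_1)
qed

lemma SO3_row_square:
  assumes "M \<in> SO3" shows "(M$i$1)\<^sup>2 + (M$i$2)\<^sup>2 + (M$i$3)\<^sup>2 = 1"
  using SO3_rows_cols(1)[OF assms, of i i] by (simp add: power2_eq_square)

text \<open>Orthonormality of the columns makes \<open>M\<close> an isometry.\<close>

lemma SO3_parseval:
  assumes "M \<in> SO3"
  shows "(u1 * M$1$1 + u2 * M$1$2 + u3 * M$1$3)\<^sup>2 + (u1 * M$2$1 + u2 * M$2$2 + u3 * M$2$3)\<^sup>2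
    + (u1 * M$3$1 + u2 * M$3$2 + u3 * M$3$3)\<^sup>2 = u1\<^sup>2 + u2\<^sup>2 + u3\<^sup>2"
proof -
  note c = SO3_rows_cols(2)[OF assms]
  have "M$1$1 * M$1$1 + M$2$1 * M$2$1 + M$3$1 * M$3$1 = 1"
    "M$1$2 * M$1$2 + M$2$2 * M$2$2 + M$3$2 * M$3$2 = 1"
    "M$1$3 * M$1$3 + M$2$3 * M$2$3 + M$3$3 * M$3$3 = 1"
    "M$1$1 * M$1$2 + M$2$1 * M$2$2 + M$3$1 * M$3$2 = 0"
    "M$1$2 * M$1$3 + M$2$2 * M$2$3 + M$3$2 * M$3$3 = 0"
    "M$1$1 * M$1$3 + M$2$1 * M$2$3 + M$3$1 * M$3$3 = 0"
    by (simp_all add: c)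
  then show ?thesis by algebra
qed

text \<open>This is \<open>\<alpha>\<^sub>p \<cdot> M\<^sub>q - \<alpha>\<^sub>q \<cdot>
  M\<^sub>p\<close>, the divergence of \<open>M\<^sub>p \<times> M\<^sub>q\<close> with the curls of
  the two rows replaced by their prescribed values.\<close>

definition div_term :: "real^3^3 \<Rightarrow> 3 \<Rightarrow> 3 \<Rightarrow> real^3^3 \<Rightarrow> real" where
  "div_term \<alpha> p q M = (\<alpha>$p$1 * M$q$1 + \<alpha>$p$2 * M$q$2 + \<alpha>$p$3 * M$q$3)
    - (\<alpha>$q$1 * M$p$1 + \<alpha>$q$2 * M$p$2 + \<alpha>$q$3 * M$p$3)"

text \<open>This is \<open>\<alpha>\<^sub>i \<cdot> (d \<times> M\<^sub>i) = d \<cdot> (M\<^sub>i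
  \<times> \<alpha>\<^sub>i)\<close>. With \<open>d\<close> the gradient of the cutoff it is the
  term \<open>v \<times> curl v\<close> of the integral identity.\<close>

definition curl_term :: "real^3^3 \<Rightarrow> 3 \<Rightarrow> (3 \<Rightarrow> real) \<Rightarrow> real^3^3 \<Rightarrow> real" where
  "curl_term \<alpha> i d M = \<alpha>$i$1 * (d 2 * M$i$3 - d 3 * M$i$2) + \<alpha>$i$2 * (d 3 * M$i$1 - d 1 * M$i$3)
    + \<alpha>$i$3 * (d 1 * M$i$2 - d 2 * M$i$1)"

definition row_term :: "(3 \<Rightarrow> real) \<Rightarrow> 3 \<Rightarrow> real^3^3 \<Rightarrow> real" where
  "row_term d i M = d 1 * M$i$1 + d 2 * M$i$2 + d 3 * M$i$3"

text \<open>The vector triple product formula applied to \<open>d \<times> M\<^sub>i = d \<times> (M\<^sub>p \<times> M\<^sub>q)\<close>.\<close>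
lemma SO3_curl_term:
  assumes "M \<in> SO3" "cyclic3 i p q"
  shows "curl_term \<alpha> i d M =
    row_term d q M * (\<alpha>$i$1 * M$p$1 + \<alpha>$i$2 * M$p$2 + \<alpha>$i$3 * M$p$3)
    - row_term d p M * (\<alpha>$i$1 * M$q$1 + \<alpha>$i$2 * M$q$2 + \<alpha>$i$3 * M$q$3)"
  unfolding curl_term_def row_term_def SO3_cofactor[OF assms] by algebra

text \<open>Adding the three triple product expansions and collecting the factors of each
  \<open>row_term\<close> produces the divergence expressions. The quadratic terms on the left
  thereby become linear in \<open>M\<close>, and their integrals are known from the curl
  equation.\<close>

lemma SO3_sum_row_div:
  assumes "M \<in> SO3"
  shows "row_term d 1 M * div_term \<alpha> 2 3 M + row_term d 2 M * div_term \<alpha> 3 1 M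
      + row_term d 3 M * div_term \<alpha> 1 2 M
    = curl_term \<alpha> 1 d M + curl_term \<alpha> 2 d M + curl_term \<alpha> 3 d M"
proof -
  have "curl_term \<alpha> 1 d M = row_term d 3 M * (\<alpha>$1$1 * M$2$1 + \<alpha>$1$2 * M$2$2 + \<alpha>$1$3 * M$2$3)
      - row_term d 2 M * (\<alpha>$1$1 * M$3$1 + \<alpha>$1$2 * M$3$2 + \<alpha>$1$3 * M$3$3)"
    "curl_term \<alpha> 2 d M = row_term d 1 M * (\<alpha>$2$1 * M$3$1 + \<alpha>$2$2 * M$3$2 + \<alpha>$2$3 * M$3$3)
      - row_term d 3 M * (\<alpha>$2$1 * M$1$1 + \<alpha>$2$2 * M$1$2 + \<alpha>$2$3 * M$1$3)"
    "curl_term \<alpha> 3 d M = row_term d 2 M * (\<alpha>$3$1 * M$1$1 + \<alpha>$3$2 * M$1$2 + \<alpha>$3$3 * M$1$3)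
      - row_term d 1 M * (\<alpha>$3$1 * M$2$1 + \<alpha>$3$2 * M$2$2 + \<alpha>$3$3 * M$2$3)"
    by (rule SO3_curl_term[OF assms], simp)+
  then show ?thesis
    unfolding div_term_def by (simp add: algebra_simps)
qed

definition norm_sq_row :: "real^3^3 \<Rightarrow> 3 \<Rightarrow> real" where
  "norm_sq_row \<alpha> i = (\<alpha>$i$1)\<^sup>2 + (\<alpha>$i$2)\<^sup>2 + (\<alpha>$i$3)\<^sup>2"

text \<open>In the orthonormal basis of the rows of \<open>M\<close>, the entries of \<alpha> become
  \<open>m p q\<close>. Each divergence expression is a difference of two off-diagonal entries,
  bounded by \<open>(a - b)^2 \<le> 2 * (a^2 + b^2)\<close>; the diagonal squares are added for
  free.\<close>

lemma SO3_sum_div_squares: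
  assumes "M \<in> SO3"
  shows "(div_term \<alpha> 2 3 M)\<^sup>2 + (div_term \<alpha> 3 1 M)\<^sup>2 + (div_term \<alpha> 1 2 M)\<^sup>2
    \<le> 2 * (norm_sq_row \<alpha> 1 + norm_sq_row \<alpha> 2 + norm_sq_row \<alpha> 3)"
proof -
  define m where "m p q = \<alpha>$p$1 * M$q$1 + \<alpha>$p$2 * M$q$2 + \<alpha>$p$3 * M$q$3" for p q
  have p: "norm_sq_row \<alpha> p = (m p 1)\<^sup>2 + (m p 2)\<^sup>2 + (m p 3)\<^sup>2" for p
    unfolding norm_sq_row_def m_def by (rule SO3_parseval[OF assms, symmetric])
  have s: "(a - b)\<^sup>2 \<le> 2 * (a\<^sup>2 + b\<^sup>2)" for a b :: real
    using zero_le_power2[of "a + b"] by (simp add: power2_eq_square algebra_simps)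
  have d: "(div_term \<alpha> p q M)\<^sup>2 \<le> 2 * ((m p q)\<^sup>2 + (m q p)\<^sup>2)" for p q
    unfolding div_term_def m_def by (rule s)
  have "0 \<le> (m 1 1)\<^sup>2" "0 \<le> (m 2 2)\<^sup>2" "0 \<le> (m 3 3)\<^sup>2" by simp_all
  with d[of 2 3] d[of 3 1] d[of 1 2] show ?thesis
    unfolding p distrib_left by linarith
qed

section \<open>Measurability, size and support estimates\<close>

lemma borel_measurable_matrix:
  fixes M :: "'a::topological_space \<Rightarrow> real^'n::finite^'m::finite"
  assumes "\<And>i l. (\<lambda>x. M x $ i $ l) \<in> borel_measurable borel"
  shows "M \<in> borel_measurable borel"
proof (subst borel_measurable_euclidean_space, intro ballI)
  fix b :: "real^'n^'m" assume "b \<in> Basis"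
  then obtain i l where "b = axis i (axis l 1)"
    by (auto simp: Basis_vec_def)
  then show "(\<lambda>x. M x \<bullet> b) \<in> borel_measurable borel"
    using assms by (simp add: inner_axis)
qed

lemma matrix_norm_le:
  fixes M :: "real^3^3"
  assumes "\<And>i l. \<bar>M $ i $ l\<bar> \<le> 1"
  shows "norm M \<le> 9"
proof -
  have "norm (M $ i) \<le> 3" for i
    using norm_le_l1_cart[of "M $ i"] assms[of i 1] assms[of i 2] assms[of i 3] by (simp add: sum_3)
  then have "norm (M $ 1) + norm (M $ 2) + norm (M $ 3) \<le> 9"
    by (smt (verit))
  moreover have "norm M \<le> (\<Sum>i\<in>UNIV. norm (M $ i))"
    unfolding norm_vec_def by (rule L2_set_le_sum) simp
  ultimately show ?thesis by (simp add: sum_3)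
qed

lemma partial_deriv_bump_outside:
  assumes "r > 0" "dist x a > r"
  shows "partial_deriv k (bump a r) x = 0"
    and "partial_deriv j (partial_deriv k (bump a r)) x = 0"
proof -
  have 1: "partial_deriv k (bump a r) y = 0" if "y \<in> - cball a r" for y
    by (rule partial_deriv_vanishes[of "- cball a r" y _ 0])
      (use that assms(1) in \<open>auto intro!: bump_eq_0 simp: dist_commute open_Compl\<close>)
  have x: "x \<in> - cball a r" using assms(2) by (simp add: dist_commute)
  show "partial_deriv k (bump a r) x = 0" by (rule 1[OF x])
  show "partial_deriv j (partial_deriv k (bump a r)) x = 0"
    by (rule partial_deriv_vanishes[of "- cball a r" x _ 0]) (use x 1 in \<open>auto simp: open_Compl\<close>)
qed

lemma integrable_mult_compact_support:
  fixes f g :: "real^'n::finite \<Rightarrow> real"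
  assumes "integrable lborel f" "continuous_on UNIV g" "vanishes_beyond r g"
  shows "integrable lborel (\<lambda>y. f y * g y)"
proof -
  \<comment> \<open>The product is the convolution integrand at the origin for the reflected second
    factor.\<close>
  have "integrable lborel (\<lambda>y. f y * (\<lambda>z. g (- z)) (0 - y))"
    by (rule conv_integrable[where r=r])
      (use assms in \<open>auto intro!: continuous_on_compose2[OF assms(2)] continuous_intros simp: vanishes_beyond_def\<close>)
  then show ?thesis by simp
qed

section \<open>The mollified rotation field\<close>

text \<open>\<open>F\<close> is to be a Borel version of the given field on all of space, zero far
  out so that it can be convolved, and a rotation only almost everywhere in \<Omega>. The curl
  equation is recorded against bumps, the test functions that mollification produces, and
  \<open>s\<close> is a subsequence with almost everywhere convergence.\<close>

locale mollified_rotation =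
  fixes \<Omega> :: "(real^3) set" and F :: "real^3 \<Rightarrow> real^3^3" and \<alpha> :: "real^3^3"
    and \<rho> :: real and s :: "nat \<Rightarrow> nat"
  assumes open_domain: "open \<Omega>"
    and F_borel: "\<And>i l. (\<lambda>x. F x $ i $ l) \<in> borel_measurable borel"
    and F_bound: "\<And>i l x. \<bar>F x $ i $ l\<bar> \<le> 1"
    and F_vanishes: "\<And>i l. vanishes_beyond \<rho> (\<lambda>x. F x $ i $ l)"
    and F_SO3: "AE x in lborel. x \<in> \<Omega> \<longrightarrow> F x \<in> SO3"
    and F_curl: "\<And>a r i j k l. r > 0 \<Longrightarrow> cball a r \<subseteq> \<Omega> \<Longrightarrow> cyclic3 j k l \<Longrightarrow>
      (\<integral>x. F x $ i $ l * partial_deriv k (bump a r) x - F x $ i $ k * partial_deriv l (bump a r) x \<partial>lborel)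
      = - (\<alpha> $ i $ j * (\<integral>x. bump a r x \<partial>lborel))"
    and s_mono: "strict_mono s"
    and s_lim: "AE x in lborel. \<forall>i l. (\<lambda>n. mollify (s n) (\<lambda>x. F x $ i $ l) x) \<longlonglongrightarrow> F x $ i $ l"
begin

section \<open>Mollified entries and passage to the limit\<close>

definition \<delta> :: "nat \<Rightarrow> real" where "\<delta> n = 1 / real (Suc (s n))"

definition V :: "nat \<Rightarrow> 3 \<Rightarrow> 3 \<Rightarrow> real^3 \<Rightarrow> real" where
  "V n i l = mollify (s n) (\<lambda>x. F x $ i $ l)"

definition W :: "nat \<Rightarrow> real^3 \<Rightarrow> real^3^3" where "W n x = (\<chi> i l. V n i l x)"

lemma W_nth [simp]: "W n x $ i $ l = V n i l x" by (simp add: W_def)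

lemma \<delta>_pos [simp]: "\<delta> n > 0" by (simp add: \<delta>_def)

lemma F_integrable: "integrable lborel (\<lambda>x. F x $ i $ l)"
  by (rule integrable_bounded_support[OF F_borel F_bound F_vanishes])

lemma V_conv: "V n i l = conv (\<lambda>x. F x $ i $ l) (mollifier (\<delta> n))"
  by (simp add: V_def mollify_def \<delta>_def)

lemma V_smooth: "smooth_fun (V n i l)"
  unfolding V_conv by (rule smooth_fun_conv[OF F_integrable smooth_fun_mollifier mollifier_vanishes_beyond]) simp

lemma V_partial_deriv: "partial_deriv k (V n i l) = conv (\<lambda>x. F x $ i $ l) (partial_deriv k (mollifier (\<delta> n)))"
  unfolding V_conv by (rule conv_partial_deriv[OF F_integrable smooth_fun_mollifier mollifier_vanishes_beyond]) simp

text \<open>Both derivatives fall on the kernel, where the symmetry was computed explicitly.\<close>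

lemma V_commute: "partial_deriv j (partial_deriv k (V n i l)) = partial_deriv k (partial_deriv j (V n i l))"
proof -
  let ?c = "inverse (\<integral>y. bump (0::real^3) (\<delta> n) y \<partial>lborel)"
  have m: "partial_deriv j (partial_deriv k (mollifier (\<delta> n) :: real^3 \<Rightarrow> real)) =
      (\<lambda>x. ?c * partial_deriv j (partial_deriv k (bump 0 (\<delta> n))) x)" for j k
  proof -
    have "partial_deriv k (mollifier (\<delta> n) :: real^3 \<Rightarrow> real) = (\<lambda>x. ?c * partial_deriv k (bump 0 (\<delta> n)) x)" for k
      unfolding mollifier_def[abs_def] by (rule ext) (simp add: partial_deriv_smooth_simps)
    then show ?thesis
      by (intro ext) (simp add: partial_deriv_smooth_simps)
  qed
  have "partial_deriv j (partial_deriv k (V n i l)) =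
      conv (\<lambda>x. F x $ i $ l) (partial_deriv j (partial_deriv k (mollifier (\<delta> n))))" for j k
    unfolding V_partial_deriv
    by (rule conv_partial_deriv[OF F_integrable smooth_fun_partial_deriv[OF smooth_fun_mollifier]
        partial_deriv_support[OF mollifier_vanishes_beyond]]) simp
  then show ?thesis
    by (simp only: m partial_deriv_bump_commute)
qed

lemma V_bound: "\<bar>V n i l x\<bar> \<le> 1"
  unfolding V_conv by (rule conv_mollifier_bound[OF F_integrable F_bound]) simp

lemma F_matrix_borel: "F \<in> borel_measurable borel"
  by (rule borel_measurable_matrix[OF F_borel])

lemma W_borel: "W n \<in> borel_measurable borel"
  by (rule borel_measurable_matrix) (simp add: smooth_fun_borel V_smooth)

lemma W_tendsto: "AE x in lborel. (\<lambda>n. W n x) \<longlonglongrightarrow> F x"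
  using s_lim
proof (rule eventually_mono)
  fix x assume *: "\<forall>i l. (\<lambda>n. mollify (s n) (\<lambda>x. F x $ i $ l) x) \<longlonglongrightarrow> F x $ i $ l"
  show "(\<lambda>n. W n x) \<longlonglongrightarrow> F x"
    by (intro vec_tendstoI) (use * in \<open>simp add: V_def\<close>)
qed

text \<open>All limits of integrals along the mollified field use this. Both fields stay among
  matrices of norm at most 9, so \<open>P\<close> is bounded on a compact set and dominated
  convergence applies to any continuous, possibly nonlinear, expression without derivatives of the
  field.\<close>

lemma integral_tendsto:
  fixes P :: "real^3 \<Rightarrow> real^3^3 \<Rightarrow> real"
  assumes cont: "continuous_on UNIV (\<lambda>z. P (fst z) (snd z))" and supp: "\<And>x M. norm x > r \<Longrightarrow> P x M = 0"
  shows "(\<lambda>n. \<integral>x. P x (W n x) \<partial>lborel) \<longlonglongrightarrow> (\<integral>x. P x (F x) \<partial>lborel)"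
    and "integrable lborel (\<lambda>x. P x (F x))"
    and "\<And>n. integrable lborel (\<lambda>x. P x (W n x))"
proof -
  let ?K = "cball 0 r \<times> cball 0 9 :: ((real^3) \<times> (real^3^3)) set"
  have "bounded ((\<lambda>z. P (fst z) (snd z)) ` ?K)"
    by (intro compact_imp_bounded compact_continuous_image continuous_on_subset[OF cont] compact_Times) auto
  then obtain C where C: "\<forall>y\<in>(\<lambda>z. P (fst z) (snd z)) ` ?K. norm y \<le> C"
    unfolding bounded_iff by blast
  have bound: "\<bar>P x M\<bar> \<le> \<bar>C\<bar> * indicator (cball 0 r) x" if "norm M \<le> 9" for x M
  proof (cases "norm x \<le> r")
    case True
    then have "(x, M) \<in> ?K" using that by simp
    then have "norm (P x M) \<le> C" using C by force
    then show ?thesis using True by simp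
  qed (use supp in simp)
  have meas: "(\<lambda>x. P x (M x)) \<in> borel_measurable borel" if "M \<in> borel_measurable borel" for M
  proof -
    have "(\<lambda>x. (x, M x)) \<in> borel \<rightarrow>\<^sub>M borel"
      using that by (intro borel_measurable_Pair) simp_all
    from measurable_compose[OF this borel_measurable_continuous_onI[OF cont]] show ?thesis by simp
  qed
  have nF: "norm (F x) \<le> 9" and nW: "norm (W n x) \<le> 9" for x n
    using matrix_norm_le F_bound V_bound by simp_all
  have ind: "integrable lborel (\<lambda>x. \<bar>C\<bar> * indicator (cball (0::real^3) r) x)"
    using emeasure_bounded_finite[OF bounded_cball]
    by (intro integrable_mult_right integrable_real_indicator) auto
  have F: "(\<lambda>x. P x (F x)) \<in> borel_measurable lborel"
    using meas[OF F_matrix_borel] by simp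
  have W: "(\<lambda>x. P x (W n x)) \<in> borel_measurable lborel" for n
    using meas[OF W_borel] by simp
  have lim: "AE x in lborel. (\<lambda>n. P x (W n x)) \<longlonglongrightarrow> P x (F x)"
    using W_tendsto
  proof (rule eventually_mono)
    fix x assume "(\<lambda>n. W n x) \<longlonglongrightarrow> F x"
    then have "(\<lambda>n. (x, W n x)) \<longlonglongrightarrow> (x, F x)" by (intro tendsto_Pair tendsto_const)
    from continuous_on_tendsto_compose[OF cont this] show "(\<lambda>n. P x (W n x)) \<longlonglongrightarrow> P x (F x)"
      by simp
  qed
  have dom: "AE x in lborel. norm (P x (W n x)) \<le> \<bar>C\<bar> * indicator (cball 0 r) x" for n
    by (intro AE_I2) (simp only: real_norm_def bound[OF nW])
  show "(\<lambda>n. \<integral>x. P x (W n x) \<partial>lborel) \<longlonglongrightarrow> (\<integral>x. P x (F x) \<partial>lborel)"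
    by (rule integral_dominated_convergence[OF F W ind lim dom])
  show "integrable lborel (\<lambda>x. P x (F x))"
    by (rule integrable_dominated_convergence[OF F W ind lim dom])
  show "\<And>n. integrable lborel (\<lambda>x. P x (W n x))"
    by (rule integrable_dominated_convergence2[OF F W ind lim dom])
qed

section \<open>The differential equations of the mollified field\<close>

definition good :: "nat \<Rightarrow> real^3 \<Rightarrow> bool" where "good n x \<longleftrightarrow> cball x (\<delta> n) \<subseteq> \<Omega>"

text \<open>A compact ball in the open set \<Omega> has a uniform margin, and the kernel radii
  shrink below it. At a good point the kernel is supported in \<Omega>, so the equations may be
  tested with it.\<close>

lemma eventually_good:
  assumes "cball a r \<subseteq> \<Omega>"
  shows "\<forall>\<^sub>F n in sequentially. \<forall>x\<in>cball a r. good n x"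
proof -
  obtain e where e: "e > 0" "(\<Union>x\<in>cball a r. cball x e) \<subseteq> \<Omega>"
    using compact_subset_open_imp_cball_epsilon_subset[OF compact_cball open_domain assms] by blast
  obtain N where N: "1 / real (Suc N) < e"
    using e(1) nat_approx_posE by blast
  have "\<forall>x\<in>cball a r. good n x" if "n \<ge> N" for n
  proof
    fix x assume x: "x \<in> cball a r"
    have "N \<le> s n" using that seq_suble[OF s_mono, of n] by simp
    then have "\<delta> n \<le> 1 / real (Suc N)"
      unfolding \<delta>_def by (intro divide_left_mono) auto
    then have "cball x (\<delta> n) \<subseteq> cball x e" using N by auto
    then show "good n x" using e(2) x unfolding good_def by blast
  qed
  then show ?thesis unfolding eventually_sequentially by blast
qed

definition scale :: "nat \<Rightarrow> real" where "scale n = inverse (\<integral>y. bump (0::real^3) (\<delta> n) y \<partial>lborel)"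

lemma V_eq: "V n i l x = scale n * (\<integral>y. F y $ i $ l * bump x (\<delta> n) y \<partial>lborel)"
  unfolding V_conv conv_def mollifier_reflect scale_def[symmetric] by (simp add: mult.left_commute)

lemma V_partial_deriv_eq:
  "partial_deriv k (V n i l) x = - (scale n * (\<integral>y. F y $ i $ l * partial_deriv k (bump x (\<delta> n)) y \<partial>lborel))"
  unfolding V_partial_deriv conv_def partial_deriv_mollifier_reflect scale_def[symmetric]
  by (simp add: mult.left_commute)

lemma scale_bump: "scale n * (\<integral>y. bump (x :: real^3) (\<delta> n) y \<partial>lborel) = 1"
  using mollifier_shift_integral[OF \<delta>_pos, of n x] unfolding mollifier_reflect scale_def[symmetric] by simp

lemma F_mult_integrable:
  assumes "r > 0"
  shows "integrable lborel (\<lambda>y. F y $ i $ l * bump x r y)"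
    and "integrable lborel (\<lambda>y. F y $ i $ l * partial_deriv k (bump x r) y)"
  by (rule integrable_mult_compact_support[OF F_integrable smooth_fun_continuous_on
      bump_vanishes_beyond[OF assms]], simp)
    (rule integrable_mult_compact_support[OF F_integrable smooth_fun_continuous_on
      partial_deriv_support[OF bump_vanishes_beyond[OF assms]]], simp add: smooth_fun_partial_deriv)

text \<open>The derivatives fall on the kernel, which is a scaled bump inside \<Omega>; reflection
  of the kernel contributes the sign that cancels the one in \<open>F_curl\<close>.\<close>

lemma V_curl:
  assumes "good n x" "cyclic3 j k l"
  shows "partial_deriv k (V n i l) x - partial_deriv l (V n i k) x = \<alpha> $ i $ j"
proof -
  have "partial_deriv k (V n i l) x - partial_deriv l (V n i k) x =
    - (scale n * (\<integral>y. F y $ i $ l * partial_deriv k (bump x (\<delta> n)) y - F y $ i $ k * partial_deriv l (bump x (\<delta> n)) y \<partial>lborel))"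
    unfolding V_partial_deriv_eq
    by (simp add: F_mult_integrable[OF \<delta>_pos] right_diff_distrib)
  also have "\<dots> = \<alpha> $ i $ j * (scale n * (\<integral>y. bump x (\<delta> n) y \<partial>lborel))"
    using F_curl[OF \<delta>_pos[of n] _ assms(2), where a=x and i=i] assms(1) by (simp add: good_def)
  finally show ?thesis by (simp add: scale_bump)
qed

text \<open>The weak form of \<open>div r\<^sub>i = div_term \<alpha> p q\<close>. Mollified rows
  \<open>p\<close> and \<open>q\<close> have the prescribed curls, so integrating the divergence of
  their cross product against the cutoff is exact; in the limit that cross product becomes row
  \<open>i\<close>, because \<open>F\<close> is a rotation almost everywhere.\<close>

lemma cross_zero:
  assumes "r > 0" and ball: "cball a r \<subseteq> \<Omega>" and cyc: "cyclic3 i p q"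
  shows "(\<integral>x. row_term (\<lambda>j. partial_deriv j (bump a r) x) i (F x) + bump a r x * div_term \<alpha> p q (F x) \<partial>lborel) = 0"
proof -
  define \<phi> where "\<phi> = bump a r"
  have \<phi>: "smooth_fun \<phi>" "vanishes_beyond (norm a + r) \<phi>"
    using bump_vanishes_beyond[OF \<open>r > 0\<close>] by (simp_all add: \<phi>_def)
  have out: "\<phi> x = 0" "partial_deriv j \<phi> x = 0" if "x \<notin> cball a r" for x j
    unfolding \<phi>_def using that \<open>r > 0\<close>
    by (auto intro!: bump_eq_0 partial_deriv_bump_outside simp: dist_commute)
  \<comment> \<open>Row \<open>i\<close> is written as the cross product of the other two, since the
    mollified matrices need not satisfy the cofactor identity.\<close>
  define P where "P x M = partial_deriv 1 \<phi> x * (M$p$2 * M$q$3 - M$p$3 * M$q$2)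
    + partial_deriv 2 \<phi> x * (M$p$3 * M$q$1 - M$p$1 * M$q$3)
    + partial_deriv 3 \<phi> x * (M$p$1 * M$q$2 - M$p$2 * M$q$1) + \<phi> x * div_term \<alpha> p q M"
    for x and M :: "real^3^3"
  have "continuous_on UNIV (\<lambda>z. P (fst z) (snd z))"
    unfolding P_def div_term_def
    by (intro continuous_intros continuous_on_compose2[OF smooth_fun_continuous_on[of _ UNIV]]
        smooth_fun_partial_deriv \<phi>(1)) auto
  moreover have "P x M = 0" if "norm x > norm a + r" for x M
    using vanishes_beyondD[OF \<phi>(2) that] vanishes_beyondD[OF partial_deriv_support[OF \<phi>(2)] that]
    by (simp add: P_def)
  ultimately have lim: "(\<lambda>n. \<integral>x. P x (W n x) \<partial>lborel) \<longlonglongrightarrow> (\<integral>x. P x (F x) \<partial>lborel)"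
    by (rule integral_tendsto(1))
  have "\<forall>\<^sub>F n in sequentially. (\<integral>x. P x (W n x) \<partial>lborel) = 0"
    using eventually_good[OF ball]
  proof (rule eventually_mono)
    fix n assume good: "\<forall>x\<in>cball a r. good n x"
    show "(\<integral>x. P x (W n x) \<partial>lborel) = 0"
    proof (rule trans[OF Bochner_Integration.integral_cong[OF refl]
          integral_cross_eq_0[OF \<phi>, of "V n p" "V n q"]])
      fix x
      show "P x (W n x) = partial_deriv 1 \<phi> x * (V n p 2 x * V n q 3 x - V n p 3 x * V n q 2 x)
        + partial_deriv 2 \<phi> x * (V n p 3 x * V n q 1 x - V n p 1 x * V n q 3 x)
        + partial_deriv 3 \<phi> x * (V n p 1 x * V n q 2 x - V n p 2 x * V n q 1 x)
        + \<phi> x * (V n q 1 x * (partial_deriv 2 (V n p 3) x - partial_deriv 3 (V n p 2) x)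
          + V n q 2 x * (partial_deriv 3 (V n p 1) x - partial_deriv 1 (V n p 3) x)
          + V n q 3 x * (partial_deriv 1 (V n p 2) x - partial_deriv 2 (V n p 1) x)
          - V n p 1 x * (partial_deriv 2 (V n q 3) x - partial_deriv 3 (V n q 2) x)
          - V n p 2 x * (partial_deriv 3 (V n q 1) x - partial_deriv 1 (V n q 3) x)
          - V n p 3 x * (partial_deriv 1 (V n q 2) x - partial_deriv 2 (V n q 1) x))"
      proof (cases "x \<in> cball a r")
        case True
        with good have "good n x" by blast
        note curl = V_curl[OF this]
        show ?thesis
          unfolding P_def div_term_def curl[OF cyclic3_simps(1)] curl[OF cyclic3_simps(2)]
            curl[OF cyclic3_simps(3)] W_nth
          by (simp add: algebra_simps)
      qed (simp add: P_def out)
    qed (simp_all add: V_smooth)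
  qed
  then have "(\<integral>x. P x (F x) \<partial>lborel) = 0"
    by (rule LIMSEQ_unique[OF lim tendsto_eventually])
  moreover have "(\<integral>x. P x (F x) \<partial>lborel) =
      (\<integral>x. row_term (\<lambda>j. partial_deriv j \<phi> x) i (F x) + \<phi> x * div_term \<alpha> p q (F x) \<partial>lborel)"
  proof (rule integral_cong_AE)
    show "AE x in lborel. P x (F x) = row_term (\<lambda>j. partial_deriv j \<phi> x) i (F x) + \<phi> x * div_term \<alpha> p q (F x)"
      using F_SO3
    proof (rule eventually_mono)
      fix x assume SO3: "x \<in> \<Omega> \<longrightarrow> F x \<in> SO3"
      show "P x (F x) = row_term (\<lambda>j. partial_deriv j \<phi> x) i (F x) + \<phi> x * div_term \<alpha> p q (F x)"
      proof (cases "x \<in> cball a r")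
        case True
        then have "F x \<in> SO3" using SO3 ball by blast
        then show ?thesis
          unfolding P_def row_term_def by (simp only: SO3_cofactor[OF _ cyc])
      qed (simp add: P_def row_term_def out)
    qed
    have [measurable]: "(\<lambda>x. F x $ i $ l) \<in> borel_measurable borel" for i l by (rule F_borel)
    have [measurable]: "\<phi> \<in> borel_measurable borel" "partial_deriv j \<phi> \<in> borel_measurable borel" for j
      by (intro smooth_fun_borel smooth_intros \<phi>(1))+
    show "(\<lambda>x. P x (F x)) \<in> borel_measurable lborel"
      unfolding P_def div_term_def by simp
    show "(\<lambda>x. row_term (\<lambda>j. partial_deriv j \<phi> x) i (F x) + \<phi> x * div_term \<alpha> p q (F x)) \<in> borel_measurable lborel"
      unfolding row_term_def div_term_def by simp
  qed
  ultimately show ?thesis by (simp add: \<phi>_def)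
qed

text \<open>The relation of \<open>cross_zero\<close> is linear in \<open>F\<close>, so testing it
  with the kernel gives the divergence equation pointwise for the mollified field, even where
  \<open>W n x\<close> is not a rotation.\<close>

lemma V_div:
  assumes "good n x" "cyclic3 i p q"
  shows "partial_deriv 1 (V n i 1) x + partial_deriv 2 (V n i 2) x + partial_deriv 3 (V n i 3) x
    = div_term \<alpha> p q (W n x)"
proof -
  let ?b = "bump x (\<delta> n)"
  note [simp] = F_mult_integrable[OF \<delta>_pos]
  have "0 = scale n * (\<integral>y. row_term (\<lambda>j. partial_deriv j ?b y) i (F y) + ?b y * div_term \<alpha> p q (F y) \<partial>lborel)"
    using cross_zero[OF \<delta>_pos[of n] _ assms(2), where a=x] assms(1) by (simp add: good_def)
  also have "(\<lambda>y. row_term (\<lambda>j. partial_deriv j ?b y) i (F y) + ?b y * div_term \<alpha> p q (F y)) =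
    (\<lambda>y. (F y$i$1 * partial_deriv 1 ?b y + F y$i$2 * partial_deriv 2 ?b y + F y$i$3 * partial_deriv 3 ?b y)
      + ((\<alpha>$p$1 * (F y$q$1 * ?b y) + \<alpha>$p$2 * (F y$q$2 * ?b y) + \<alpha>$p$3 * (F y$q$3 * ?b y))
      - (\<alpha>$q$1 * (F y$p$1 * ?b y) + \<alpha>$q$2 * (F y$p$2 * ?b y) + \<alpha>$q$3 * (F y$p$3 * ?b y))))"
    by (rule ext) (simp add: row_term_def div_term_def algebra_simps)
  also have "integral\<^sup>L lborel \<dots> =
    ((\<integral>y. F y$i$1 * partial_deriv 1 ?b y \<partial>lborel) + (\<integral>y. F y$i$2 * partial_deriv 2 ?b y \<partial>lborel)
      + (\<integral>y. F y$i$3 * partial_deriv 3 ?b y \<partial>lborel))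
      + ((\<alpha>$p$1 * (\<integral>y. F y$q$1 * ?b y \<partial>lborel) + \<alpha>$p$2 * (\<integral>y. F y$q$2 * ?b y \<partial>lborel)
        + \<alpha>$p$3 * (\<integral>y. F y$q$3 * ?b y \<partial>lborel))
      - (\<alpha>$q$1 * (\<integral>y. F y$p$1 * ?b y \<partial>lborel) + \<alpha>$q$2 * (\<integral>y. F y$p$2 * ?b y \<partial>lborel)
        + \<alpha>$q$3 * (\<integral>y. F y$p$3 * ?b y \<partial>lborel)))"
    by simp
  finally show ?thesis
    unfolding V_partial_deriv_eq div_term_def W_nth V_eq by (simp add: algebra_simps)
qed

end

section \<open>Vanishing of the curl and of the weak gradient\<close>

context mollified_rotation
begin

section \<open>The energy identity for one row\<close>

definition laplace :: "(real^3 \<Rightarrow> real) \<Rightarrow> real^3 \<Rightarrow> real" where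
  "laplace \<phi> x = partial_deriv 1 (partial_deriv 1 \<phi>) x + partial_deriv 2 (partial_deriv 2 \<phi>) x
    + partial_deriv 3 (partial_deriv 3 \<phi>) x"

definition energy :: "nat \<Rightarrow> 3 \<Rightarrow> real^3 \<Rightarrow> real" where
  "energy n i x = (partial_deriv 1 (V n i 1) x)\<^sup>2 + (partial_deriv 1 (V n i 2) x)\<^sup>2 + (partial_deriv 1 (V n i 3) x)\<^sup>2
    + (partial_deriv 2 (V n i 1) x)\<^sup>2 + (partial_deriv 2 (V n i 2) x)\<^sup>2 + (partial_deriv 2 (V n i 3) x)\<^sup>2
    + (partial_deriv 3 (V n i 1) x)\<^sup>2 + (partial_deriv 3 (V n i 2) x)\<^sup>2 + (partial_deriv 3 (V n i 3) x)\<^sup>2"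

text \<open>The terms of the integral identity that contain derivatives of the cutoff, with
  divergence and curl replaced by their prescribed values; no derivative of the field is
  left.\<close>

definition flux :: "(real^3 \<Rightarrow> real) \<Rightarrow> 3 \<Rightarrow> 3 \<Rightarrow> 3 \<Rightarrow> real^3 \<Rightarrow> real^3^3 \<Rightarrow> real" where
  "flux \<phi> i p q x M = row_term (\<lambda>j. partial_deriv j \<phi> x) i M * div_term \<alpha> p q M
    + curl_term \<alpha> i (\<lambda>j. partial_deriv j \<phi> x) M + 1 / 2 * laplace \<phi> x * norm_sq_row M i"

text \<open>On the ball, divergence and curl in \<open>integral_div_curl_identity\<close> take their
  prescribed values; off the ball every term carries a vanishing factor from the cutoff.\<close>

lemma energy_identity:
  assumes "r > 0" and good: "\<forall>x\<in>cball a r. good n x" and cyc: "cyclic3 i p q"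
  defines "\<phi> \<equiv> bump a r"
  defines "I \<equiv> \<lambda>x. \<phi> x * ((div_term \<alpha> p q (W n x))\<^sup>2 + norm_sq_row \<alpha> i - energy n i x) + flux \<phi> i p q x (W n x)"
  shows "(\<integral>x. I x \<partial>lborel) = 0" and "integrable lborel I"
proof -
  have \<phi>: "smooth_fun \<phi>" "vanishes_beyond (norm a + r) \<phi>"
    using bump_vanishes_beyond[OF \<open>r > 0\<close>] by (simp_all add: \<phi>_def)
  have out: "\<phi> x = 0" "partial_deriv j \<phi> x = 0" "partial_deriv k (partial_deriv j \<phi>) x = 0"
    if "x \<notin> cball a r" for x j k
    unfolding \<phi>_def using that \<open>r > 0\<close>
    by (auto intro!: bump_eq_0 partial_deriv_bump_outside simp: dist_commute)
  note id = integral_div_curl_identity[of \<phi> "norm a + r" "V n i", OF \<phi> V_smooth V_commute]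
  define A where "A j k = partial_deriv j (V n i k)" for j k
  define J where "J = (\<lambda>x. \<phi> x * ((A 1 1 x + A 2 2 x + A 3 3 x)\<^sup>2 - (A 1 1 x)\<^sup>2 - (A 2 2 x)\<^sup>2 - (A 3 3 x)\<^sup>2
        - 2 * A 1 2 x * A 2 1 x - 2 * A 2 3 x * A 3 2 x - 2 * A 3 1 x * A 1 3 x)
      + (partial_deriv 1 \<phi> x * V n i 1 x + partial_deriv 2 \<phi> x * V n i 2 x + partial_deriv 3 \<phi> x * V n i 3 x)
        * (A 1 1 x + A 2 2 x + A 3 3 x)
      + (partial_deriv 2 \<phi> x * V n i 3 x - partial_deriv 3 \<phi> x * V n i 2 x) * (A 2 3 x - A 3 2 x)
      + (partial_deriv 3 \<phi> x * V n i 1 x - partial_deriv 1 \<phi> x * V n i 3 x) * (A 3 1 x - A 1 3 x)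
      + (partial_deriv 1 \<phi> x * V n i 2 x - partial_deriv 2 \<phi> x * V n i 1 x) * (A 1 2 x - A 2 1 x)
      + 1 / 2 * (partial_deriv 1 (partial_deriv 1 \<phi>) x + partial_deriv 2 (partial_deriv 2 \<phi>) x
          + partial_deriv 3 (partial_deriv 3 \<phi>) x)
        * ((V n i 1 x)\<^sup>2 + (V n i 2 x)\<^sup>2 + (V n i 3 x)\<^sup>2))"
  have "I x = J x" for x
  proof (cases "x \<in> cball a r")
    case True
    with good have g: "good n x" by blast
    have div: "div_term \<alpha> p q (W n x) = A 1 1 x + A 2 2 x + A 3 3 x"
      unfolding A_def by (rule V_div[OF g cyc, symmetric])
    have curl: "\<alpha>$i$1 = A 2 3 x - A 3 2 x" "\<alpha>$i$2 = A 3 1 x - A 1 3 x" "\<alpha>$i$3 = A 1 2 x - A 2 1 x"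
      unfolding A_def by (rule V_curl[OF g, symmetric], simp)+
    have en: "energy n i x = (A 1 1 x)\<^sup>2 + (A 1 2 x)\<^sup>2 + (A 1 3 x)\<^sup>2 + (A 2 1 x)\<^sup>2 + (A 2 2 x)\<^sup>2 + (A 2 3 x)\<^sup>2
      + (A 3 1 x)\<^sup>2 + (A 3 2 x)\<^sup>2 + (A 3 3 x)\<^sup>2"
      by (simp add: energy_def A_def)
    \<comment> \<open>The trace of the squared gradient equals the full squared gradient minus the
      squared curl, which accounts for the \<open>energy\<close> term.\<close>
    show ?thesis
      unfolding I_def J_def flux_def row_term_def curl_term_def norm_sq_row_def laplace_def div curl en W_nth
      by algebra
  qed (simp add: I_def J_def flux_def row_term_def curl_term_def laplace_def out)
  then have "I = J" by blast
  then show "(\<integral>x. I x \<partial>lborel) = 0" and "integrable lborel I"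
    using id by (simp_all add: J_def A_def)
qed

lemma energy_bound:
  assumes "good n x" "cyclic3 i p q"
  shows "1 / 3 * (div_term \<alpha> p q (W n x))\<^sup>2 + 1 / 2 * norm_sq_row \<alpha> i \<le> energy n i x"
proof -
  have curl: "\<alpha>$i$1 = partial_deriv 2 (V n i 3) x - partial_deriv 3 (V n i 2) x"
    "\<alpha>$i$2 = partial_deriv 3 (V n i 1) x - partial_deriv 1 (V n i 3) x"
    "\<alpha>$i$3 = partial_deriv 1 (V n i 2) x - partial_deriv 2 (V n i 1) x"
    by (rule V_curl[OF assms(1), symmetric], simp)+
  show ?thesis
    unfolding V_div[OF assms, symmetric] norm_sq_row_def curl energy_def
    by (rule gradient_ge_div_curl)
qed

section \<open>Consequences on a fixed ball\<close>

context
  fixes a r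
  assumes r: "r > 0" and ball: "cball a r \<subseteq> \<Omega>"
begin

lemma bump_facts: "smooth_fun (bump a r)" "vanishes_beyond (norm a + r) (bump a r)"
  using bump_vanishes_beyond[OF r] by simp_all

lemma bump_out:
  assumes "x \<notin> cball a r"
  shows "bump a r x = 0" "partial_deriv j (bump a r) x = 0" "partial_deriv k (partial_deriv j (bump a r)) x = 0"
  using assms r by (auto intro!: bump_eq_0 partial_deriv_bump_outside simp: dist_commute)

lemma flux_continuous: "continuous_on UNIV (\<lambda>z. flux (bump a r) i p q (fst z) (snd z))"
  unfolding flux_def row_term_def div_term_def curl_term_def laplace_def norm_sq_row_def
  by (intro continuous_intros continuous_on_compose2[OF smooth_fun_continuous_on[of _ UNIV]]
        smooth_fun_partial_deriv bump_facts(1)) auto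

lemma bump_continuous: "continuous_on UNIV (\<lambda>z. bump a r (fst z))"
  by (intro continuous_on_compose2[OF smooth_fun_continuous_on[of _ UNIV]] continuous_intros) auto

lemma flux_vanishes: "norm x > norm a + r \<Longrightarrow> flux (bump a r) i p q x M = 0"
  using vanishes_beyondD[OF partial_deriv_support[OF bump_facts(2)]]
    vanishes_beyondD[OF partial_deriv_support[OF partial_deriv_support[OF bump_facts(2)]]]
  by (simp add: flux_def row_term_def curl_term_def laplace_def)

text \<open>The integrand of the energy identity after replacing the energy by its lower bound, with
  \<open>2 / 3 = 1 - 1 / 3\<close> and \<open>1 / 2 = 1 - 1 / 2\<close>. It is free of derivatives
  of the field, so it passes to the limit.\<close>

definition row_integrand :: "3 \<Rightarrow> 3 \<Rightarrow> 3 \<Rightarrow> real^3 \<Rightarrow> real^3^3 \<Rightarrow> real" where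
  "row_integrand i p q x M = bump a r x * (2 / 3 * (div_term \<alpha> p q M)\<^sup>2 + 1 / 2 * norm_sq_row \<alpha> i)
    + flux (bump a r) i p q x M"

lemma row_integrand_tendsto:
  "(\<lambda>n. \<integral>x. row_integrand i p q x (W n x) \<partial>lborel) \<longlonglongrightarrow> (\<integral>x. row_integrand i p q x (F x) \<partial>lborel)"
  "integrable lborel (\<lambda>x. row_integrand i p q x (F x))"
  "integrable lborel (\<lambda>x. row_integrand i p q x (W n x))"
proof -
  have c: "continuous_on UNIV (\<lambda>z. row_integrand i p q (fst z) (snd z))"
    unfolding row_integrand_def div_term_def
    by (intro continuous_intros flux_continuous bump_continuous)
  have z: "row_integrand i p q x M = 0" if "norm x > norm a + r" for x M
    using vanishes_beyondD[OF bump_facts(2) that] flux_vanishes[OF that] by (simp add: row_integrand_def)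
  show
    "(\<lambda>n. \<integral>x. row_integrand i p q x (W n x) \<partial>lborel) \<longlonglongrightarrow> (\<integral>x. row_integrand i p q x (F x) \<partial>lborel)"
    "integrable lborel (\<lambda>x. row_integrand i p q x (F x))"
    "integrable lborel (\<lambda>x. row_integrand i p q x (W n x))"
    using integral_tendsto[OF c z] by blast+
qed

lemma row_integral_nonneg:
  assumes cyc: "cyclic3 i p q"
  shows "0 \<le> (\<integral>x. row_integrand i p q x (F x) \<partial>lborel)"
proof (rule tendsto_lowerbound[OF row_integrand_tendsto(1)])
  show "\<forall>\<^sub>F n in sequentially. 0 \<le> (\<integral>x. row_integrand i p q x (W n x) \<partial>lborel)"
    using eventually_good[OF ball]
  proof (rule eventually_mono)
    fix n assume good: "\<forall>x\<in>cball a r. good n x"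
    note id = energy_identity[OF r good cyc]
    show "0 \<le> (\<integral>x. row_integrand i p q x (W n x) \<partial>lborel)"
    \<comment> \<open>Zero is rewritten as the vanishing integral of the energy identity, which
      leaves a pointwise comparison.\<close>
    proof (subst id(1)[symmetric], rule integral_mono[OF id(2) row_integrand_tendsto(3)])
      fix x
      have "bump a r x * ((div_term \<alpha> p q (W n x))\<^sup>2 + norm_sq_row \<alpha> i - energy n i x)
          \<le> bump a r x * (2 / 3 * (div_term \<alpha> p q (W n x))\<^sup>2 + 1 / 2 * norm_sq_row \<alpha> i)"
      proof (cases "x \<in> cball a r")
        case True
        with good have "good n x" by blast
        from energy_bound[OF this cyc] show ?thesis
          by (intro mult_left_mono) (simp_all add: algebra_simps)
      qed (simp add: bump_out)
      then show "bump a r x * ((div_term \<alpha> p q (W n x))\<^sup>2 + norm_sq_row \<alpha> i - energy n i x)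
          + flux (bump a r) i p q x (W n x) \<le> row_integrand i p q x (W n x)"
        by (simp add: row_integrand_def)
    qed
  qed
qed simp

text \<open>The curl equation tested with the bump, contracted with row \<open>i\<close> of
  \<alpha>.\<close>

lemma curl_term_integral:
  "(\<integral>x. curl_term \<alpha> i (\<lambda>j. partial_deriv j (bump a r) x) (F x) \<partial>lborel)
    = - (norm_sq_row \<alpha> i * (\<integral>x. bump a r x \<partial>lborel))" (is "?L = _")
  and curl_term_integrable: "integrable lborel (\<lambda>x. curl_term \<alpha> i (\<lambda>j. partial_deriv j (bump a r) x) (F x))"
proof -
  define D where "D k l x = F x $ i $ l * partial_deriv k (bump a r) x - F x $ i $ k * partial_deriv l (bump a r) x" for k l x
  have D: "integrable lborel (D k l)" for k l
    unfolding D_def by (intro Bochner_Integration.integrable_diff F_mult_integrable r)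
  have eq: "curl_term \<alpha> i (\<lambda>j. partial_deriv j (bump a r) x) (F x)
      = \<alpha>$i$1 * D 2 3 x + \<alpha>$i$2 * D 3 1 x + \<alpha>$i$3 * D 1 2 x" for x
    by (simp add: curl_term_def D_def algebra_simps)
  show "integrable lborel (\<lambda>x. curl_term \<alpha> i (\<lambda>j. partial_deriv j (bump a r) x) (F x))"
    unfolding eq by (intro Bochner_Integration.integrable_add integrable_mult_right D)
  have cD: "(\<integral>x. D k l x \<partial>lborel) = - (\<alpha> $ i $ j * (\<integral>x. bump a r x \<partial>lborel))" if "cyclic3 j k l" for j k l
    unfolding D_def by (rule F_curl[OF r ball that])
  have "?L = \<alpha>$i$1 * (\<integral>x. D 2 3 x \<partial>lborel) + \<alpha>$i$2 * (\<integral>x. D 3 1 x \<partial>lborel) + \<alpha>$i$3 * (\<integral>x. D 1 2 x \<partial>lborel)"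
    unfolding eq by (simp add: D)
  also have "\<dots> = - (norm_sq_row \<alpha> i * (\<integral>x. bump a r x \<partial>lborel))"
    by (simp add: cD[OF cyclic3_simps(1)] cD[OF cyclic3_simps(2)] cD[OF cyclic3_simps(3)]
        norm_sq_row_def power2_eq_square algebra_simps)
  finally show "?L = - (norm_sq_row \<alpha> i * (\<integral>x. bump a r x \<partial>lborel))" .
qed

lemma laplace_integral: "(\<integral>x. laplace (bump a r) x \<partial>lborel) = 0" "integrable lborel (laplace (bump a r))"
proof -
  have "partial_deriv j (partial_deriv j (bump a r)) \<in> {g. integrable lborel g \<and> (\<integral>x. g x \<partial>lborel) = 0}" for j
    using bump_facts
    by (auto intro!: integral_partial_deriv_eq_0[where r="norm a + r"] integrable_compact_support[where r="norm a + r"]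
        smooth_fun_continuous_on smooth_fun_partial_deriv partial_deriv_support)
  then show "(\<integral>x. laplace (bump a r) x \<partial>lborel) = 0" "integrable lborel (laplace (bump a r))"
    by (simp_all add: laplace_def[abs_def])
qed

text \<open>Since \<alpha> is constant, one bump decides. Summed over the rows, the limiting
  inequality reduces to a negative multiple of \<open>N * \<Phi>\<close> being nonnegative.\<close>

lemma curl_zero: "\<alpha> = 0"
proof -
  define N where "N = norm_sq_row \<alpha> 1 + norm_sq_row \<alpha> 2 + norm_sq_row \<alpha> 3"
  define \<Phi> where "\<Phi> = (\<integral>x. bump a r x \<partial>lborel)"
  define K where "K i x = curl_term \<alpha> i (\<lambda>j. partial_deriv j (bump a r) x) (F x)" for i x
  have \<Phi>: "\<Phi> > 0" unfolding \<Phi>_def by (rule bump_integral_pos[OF r])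
  note iK = curl_term_integrable[folded K_def]
  have "0 \<le> (\<integral>x. row_integrand 1 2 3 x (F x) + row_integrand 2 3 1 x (F x) + row_integrand 3 1 2 x (F x) \<partial>lborel)"
    using row_integral_nonneg[OF cyclic3_simps(1)] row_integral_nonneg[OF cyclic3_simps(2)]
      row_integral_nonneg[OF cyclic3_simps(3)]
    by (simp add: row_integrand_tendsto(2))
  \<comment> \<open>Here \<open>11 / 6 = 2 / 3 * 2 + 1 / 2\<close> comes from the bound on the
    divergence squares. The curl terms occur twice, once in \<open>flux\<close> and once through
    \<open>SO3_sum_row_div\<close>; three unit rows with weight \<open>1 / 2\<close> give the factor
    of the Laplacian.\<close>
  also have "\<dots> \<le> (\<integral>x. 11 / 6 * N * bump a r x + 2 * (K 1 x + K 2 x + K 3 x) + 3 / 2 * laplace (bump a r) x \<partial>lborel)"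
  proof (rule integral_mono_AE)
    show "integrable lborel (\<lambda>x. row_integrand 1 2 3 x (F x) + row_integrand 2 3 1 x (F x) + row_integrand 3 1 2 x (F x))"
      by (intro Bochner_Integration.integrable_add row_integrand_tendsto(2))
    show "integrable lborel (\<lambda>x. 11 / 6 * N * bump a r x + 2 * (K 1 x + K 2 x + K 3 x) + 3 / 2 * laplace (bump a r) x)"
      by (intro Bochner_Integration.integrable_add integrable_mult_right bump_integrable r iK laplace_integral(2))
    show "AE x in lborel. row_integrand 1 2 3 x (F x) + row_integrand 2 3 1 x (F x) + row_integrand 3 1 2 x (F x)
        \<le> 11 / 6 * N * bump a r x + 2 * (K 1 x + K 2 x + K 3 x) + 3 / 2 * laplace (bump a r) x"
      using F_SO3
    proof (rule eventually_mono)
      fix x assume SO3: "x \<in> \<Omega> \<longrightarrow> F x \<in> SO3"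
      show "row_integrand 1 2 3 x (F x) + row_integrand 2 3 1 x (F x) + row_integrand 3 1 2 x (F x)
        \<le> 11 / 6 * N * bump a r x + 2 * (K 1 x + K 2 x + K 3 x) + 3 / 2 * laplace (bump a r) x"
      proof (cases "x \<in> cball a r")
        case True
        then have x: "F x \<in> SO3" using SO3 ball by blast
        define S where "S = (div_term \<alpha> 2 3 (F x))\<^sup>2 + (div_term \<alpha> 3 1 (F x))\<^sup>2 + (div_term \<alpha> 1 2 (F x))\<^sup>2"
        have "bump a r x * (2 / 3 * S + 1 / 2 * N) \<le> bump a r x * (11 / 6 * N)"
        proof (rule mult_left_mono)
          have "S \<le> 2 * N" unfolding S_def N_def by (rule SO3_sum_div_squares[OF x])
          then show "2 / 3 * S + 1 / 2 * N \<le> 11 / 6 * N" by simp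
        qed simp
        moreover have "norm_sq_row (F x) i = 1" for i
          unfolding norm_sq_row_def by (rule SO3_row_square[OF x])
        moreover note SO3_sum_row_div[OF x, of "\<lambda>j. partial_deriv j (bump a r) x" \<alpha>, folded K_def]
        ultimately show ?thesis
          unfolding row_integrand_def flux_def K_def[symmetric] S_def N_def
          by (simp add: algebra_simps)
      qed (simp add: row_integrand_def flux_def K_def curl_term_def row_term_def laplace_def bump_out)
    qed
  qed
  also have "\<dots> = 11 / 6 * N * \<Phi> + 2 * (- (norm_sq_row \<alpha> 1 * \<Phi>) - norm_sq_row \<alpha> 2 * \<Phi> - norm_sq_row \<alpha> 3 * \<Phi>)"
    using iK curl_term_integral[folded K_def] laplace_integral bump_integrable[OF r, of a]
    by (simp add: \<Phi>_def)
  also have "\<dots> = - (1 / 6 * N * \<Phi>)"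
    by (simp add: N_def algebra_simps)
  finally have "N * \<Phi> \<le> 0" by simp
  then have "N \<le> 0" using \<Phi> by (simp add: mult_le_0_iff)
  moreover have nonneg: "norm_sq_row \<alpha> i \<ge> 0" for i by (simp add: norm_sq_row_def)
  ultimately have "norm_sq_row \<alpha> 1 = 0 \<and> norm_sq_row \<alpha> 2 = 0 \<and> norm_sq_row \<alpha> 3 = 0"
    using nonneg[of 1] nonneg[of 2] nonneg[of 3] unfolding N_def by linarith
  then have "norm_sq_row \<alpha> i = 0" for i
    using exhaust_3[of i] by auto
  then have "\<alpha>$i$1 = 0 \<and> \<alpha>$i$2 = 0 \<and> \<alpha>$i$3 = 0" for i
    by (simp add: norm_sq_row_def add_nonneg_eq_0_iff)
  then show ?thesis
    by (simp add: vec_eq_iff forall_3)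
qed

text \<open>With \<alpha> zero, only the Laplacian term of \<open>flux\<close> survives, and it
  equals the energy after integration. In the limit the row has length 1, and the Laplacian of the
  bump integrates to zero.\<close>

lemma energy_tendsto_0:
  assumes cyc: "cyclic3 i p q"
  shows "(\<lambda>n. \<integral>x. bump a r x * energy n i x \<partial>lborel) \<longlonglongrightarrow> 0"
    and "\<forall>\<^sub>F n in sequentially. integrable lborel (\<lambda>x. bump a r x * energy n i x)"
proof -
  define P where "P x M = 1 / 2 * laplace (bump a r) x * norm_sq_row M i" for x M
  have \<alpha>0: "\<alpha> $ j $ k = 0" for j k by (simp add: curl_zero)
  have zero: "div_term \<alpha> p q M = 0" "norm_sq_row \<alpha> i = 0" "flux (bump a r) i p q x M = P x M" for x M
    by (simp_all add: div_term_def norm_sq_row_def flux_def curl_term_def P_def \<alpha>0)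
  have c: "continuous_on UNIV (\<lambda>z. P (fst z) (snd z))"
    using flux_continuous[of i p q] by (simp only: zero)
  have z: "P x M = 0" if "norm x > norm a + r" for x M
    using flux_vanishes[OF that, of i p q M] by (simp only: zero)
  note lim = integral_tendsto[OF c z]
  have "(\<integral>x. P x (F x) \<partial>lborel) = (\<integral>x. 1 / 2 * laplace (bump a r) x \<partial>lborel)"
  proof (rule integral_cong_AE)
    show "AE x in lborel. P x (F x) = 1 / 2 * laplace (bump a r) x"
      using F_SO3
    proof (rule eventually_mono)
      fix x assume SO3: "x \<in> \<Omega> \<longrightarrow> F x \<in> SO3"
      show "P x (F x) = 1 / 2 * laplace (bump a r) x"
      proof (cases "x \<in> cball a r")
        case True
        then have "F x \<in> SO3" using SO3 ball by blast
        then show ?thesis by (simp add: P_def norm_sq_row_def SO3_row_square)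
      qed (simp add: P_def laplace_def bump_out)
    qed
    show "(\<lambda>x. P x (F x)) \<in> borel_measurable lborel"
      using lim(2) by (rule borel_measurable_integrable)
    show "(\<lambda>x. 1 / 2 * laplace (bump a r) x) \<in> borel_measurable lborel"
      using laplace_integral(2) by (intro borel_measurable_integrable integrable_mult_right)
  qed
  then have P0: "(\<lambda>n. \<integral>x. P x (W n x) \<partial>lborel) \<longlonglongrightarrow> 0"
    using lim(1) by (simp add: laplace_integral(1))
  have ev: "\<forall>\<^sub>F n in sequentially. integrable lborel (\<lambda>x. bump a r x * energy n i x) \<and>
      (\<integral>x. P x (W n x) \<partial>lborel) = (\<integral>x. bump a r x * energy n i x \<partial>lborel)"
    using eventually_good[OF ball]
  proof (rule eventually_mono)
    fix n assume good: "\<forall>x\<in>cball a r. good n x"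
    note id = energy_identity[OF r good cyc, unfolded zero]
    have eq: "bump a r x * energy n i x = P x (W n x) - (bump a r x * (0\<^sup>2 + 0 - energy n i x) + P x (W n x))" for x
      by simp
    have "integrable lborel (\<lambda>x. bump a r x * energy n i x)"
      unfolding eq by (rule Bochner_Integration.integrable_diff[OF lim(3) id(2)])
    moreover have "(\<integral>x. bump a r x * energy n i x \<partial>lborel) = (\<integral>x. P x (W n x) \<partial>lborel)"
      by (simp only: Bochner_Integration.integral_cong[OF refl eq]
          Bochner_Integration.integral_diff[OF lim(3) id(2)] id(1) diff_zero)
    ultimately show "integrable lborel (\<lambda>x. bump a r x * energy n i x) \<and>
      (\<integral>x. P x (W n x) \<partial>lborel) = (\<integral>x. bump a r x * energy n i x \<partial>lborel)" by simp
  qed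
  then show "\<forall>\<^sub>F n in sequentially. integrable lborel (\<lambda>x. bump a r x * energy n i x)"
    by (rule eventually_mono) simp
  show "(\<lambda>n. \<integral>x. bump a r x * energy n i x \<partial>lborel) \<longlonglongrightarrow> 0"
    by (rule Lim_transform_eventually[OF P0 eventually_mono[OF ev]]) simp
qed

text \<open>Integration by parts moves the derivative to the mollified entry. The inequality
  \<open>|t| \<le> e + t^2 / e\<close> bounds the result by \<open>e * \<Phi>\<close> plus a
  multiple of the energy; the energy vanishes in the limit, and \<open>e\<close> is
  arbitrary.\<close>

lemma weak_gradient_zero: "(\<integral>x. F x $ i $ l * partial_deriv k (bump a r) x \<partial>lborel) = 0"
proof -
  obtain p q where cyc: "cyclic3 i p q" by (rule cyclic3_exists)
  define G where "G = (\<integral>x. F x $ i $ l * partial_deriv k (bump a r) x \<partial>lborel)"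
  define \<Phi> where "\<Phi> = (\<integral>x. bump a r x \<partial>lborel)"
  have \<Phi>: "\<Phi> > 0" unfolding \<Phi>_def by (rule bump_integral_pos[OF r])
  have c: "continuous_on UNIV (\<lambda>z::(real^3) \<times> (real^3^3). snd z $ i $ l * partial_deriv k (bump a r) (fst z))"
    by (intro continuous_intros continuous_on_compose2[OF smooth_fun_continuous_on[of _ UNIV]]
        smooth_fun_partial_deriv bump_facts(1)) auto
  have z: "M $ i $ l * partial_deriv k (bump a r) x = 0" if "norm x > norm a + r" for x and M :: "real^3^3"
    using vanishes_beyondD[OF partial_deriv_support[OF bump_facts(2)] that] by simp
  have lim: "(\<lambda>n. \<integral>x. V n i l x * partial_deriv k (bump a r) x \<partial>lborel) \<longlonglongrightarrow> G"
    using integral_tendsto(1)[of "\<lambda>x M. M $ i $ l * partial_deriv k (bump a r) x", OF c z]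
    by (simp add: G_def)
  have bound: "\<bar>G\<bar> \<le> e * \<Phi>" if "e > 0" for e
  proof (rule LIMSEQ_le[OF tendsto_rabs[OF lim]])
    have "(\<lambda>n. e * \<Phi> + 1 / e * (\<integral>x. bump a r x * energy n i x \<partial>lborel)) \<longlonglongrightarrow> e * \<Phi> + 1 / e * 0"
      by (intro tendsto_intros energy_tendsto_0(1)[OF cyc])
    then show "(\<lambda>n. e * \<Phi> + 1 / e * (\<integral>x. bump a r x * energy n i x \<partial>lborel)) \<longlonglongrightarrow> e * \<Phi>" by simp
    have "\<forall>\<^sub>F n in sequentially. \<bar>\<integral>x. V n i l x * partial_deriv k (bump a r) x \<partial>lborel\<bar>
        \<le> e * \<Phi> + 1 / e * (\<integral>x. bump a r x * energy n i x \<partial>lborel)"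
      using energy_tendsto_0(2)[OF cyc]
    proof (rule eventually_mono)
      fix n assume i: "integrable lborel (\<lambda>x. bump a r x * energy n i x)"
      have ib: "integrable lborel (\<lambda>x. bump a r x * partial_deriv k (V n i l) x)"
        by (intro integrable_compact_support[where r="norm a + r"] smooth_fun_continuous_on smooth_intros
            vanishes_beyond_mult bump_facts V_smooth)
      have "\<bar>\<integral>x. V n i l x * partial_deriv k (bump a r) x \<partial>lborel\<bar>
          = \<bar>\<integral>x. bump a r x * partial_deriv k (V n i l) x \<partial>lborel\<bar>"
        by (simp add: integral_by_parts[OF bump_facts V_smooth])
      also have "\<dots> \<le> (\<integral>x. \<bar>bump a r x * partial_deriv k (V n i l) x\<bar> \<partial>lborel)"
        by (rule integral_abs_bound)
      also have "\<dots> \<le> (\<integral>x. e * bump a r x + 1 / e * (bump a r x * energy n i x) \<partial>lborel)"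
      proof (rule integral_mono[OF integrable_abs[OF ib]])
        show "integrable lborel (\<lambda>x. e * bump a r x + 1 / e * (bump a r x * energy n i x))"
          by (intro Bochner_Integration.integrable_add integrable_mult_right bump_integrable r i)
        fix x
        let ?t = "partial_deriv k (V n i l) x"
        have "?t\<^sup>2 \<le> energy n i x"
          using exhaust_3[of k] exhaust_3[of l] unfolding energy_def by (elim disjE) simp_all
        then have "1 / e * ?t\<^sup>2 \<le> 1 / e * energy n i x"
          using that by (intro mult_left_mono) simp_all
        moreover have "\<bar>?t\<bar> \<le> e + 1 / e * ?t\<^sup>2"
        proof -
          \<comment> \<open>Expanding this gives \<open>e * |t| \<le> e^2 + t^2\<close>.\<close>
          have "0 \<le> (\<bar>?t\<bar> - e)\<^sup>2 + e * \<bar>?t\<bar>" using that by simp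
          then have "e * \<bar>?t\<bar> \<le> e * (e + 1 / e * ?t\<^sup>2)"
            using that by (simp add: power2_eq_square algebra_simps)
          then show ?thesis using that by (simp only: mult_le_cancel_left_pos)
        qed
        ultimately have "\<bar>?t\<bar> \<le> e + 1 / e * energy n i x"
          by linarith
        then have "bump a r x * \<bar>?t\<bar> \<le> bump a r x * (e + 1 / e * energy n i x)"
          by (rule mult_left_mono) simp
        then show "\<bar>bump a r x * ?t\<bar> \<le> e * bump a r x + 1 / e * (bump a r x * energy n i x)"
          by (simp add: abs_mult algebra_simps)
      qed
      also have "\<dots> = e * \<Phi> + 1 / e * (\<integral>x. bump a r x * energy n i x \<partial>lborel)"
        using bump_integrable[OF r, of a] i by (simp add: \<Phi>_def)
      finally show "\<bar>\<integral>x. V n i l x * partial_deriv k (bump a r) x \<partial>lborel\<bar>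
        \<le> e * \<Phi> + 1 / e * (\<integral>x. bump a r x * energy n i x \<partial>lborel)" .
    qed
    then show "\<exists>N. \<forall>n\<ge>N. \<bar>\<integral>x. V n i l x * partial_deriv k (bump a r) x \<partial>lborel\<bar>
        \<le> e * \<Phi> + 1 / e * (\<integral>x. bump a r x * energy n i x \<partial>lborel)"
      by (simp only: eventually_sequentially)
  qed
  have "\<bar>G\<bar> \<le> 0 + e" if "e > 0" for e
    using bound[of "e / \<Phi>"] that \<Phi> by simp
  then have "\<bar>G\<bar> \<le> 0" by (rule field_le_epsilon)
  then show ?thesis by (simp add: G_def)
qed

end

text \<open>The gradient of a mollified entry at \<open>x\<close> is, up to a factor, the weak
  gradient tested with the bump about \<open>x\<close>, hence zero once the kernel fits into
  \<Omega>. The mollified fields are thus eventually constant on the ball, and so is their almost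
  everywhere limit.\<close>

lemma AE_constant_on_ball:
  assumes "r > 0" and ball: "cball a r \<subseteq> \<Omega>"
  obtains C where "AE x in lborel. x \<in> ball a r \<longrightarrow> F x = C"
proof -
  have const: "\<forall>\<^sub>F n in sequentially. \<forall>x\<in>ball a r. \<forall>y\<in>ball a r. W n x = W n y"
    using eventually_good[OF ball]
  proof (rule eventually_mono)
    fix n assume good: "\<forall>x\<in>cball a r. good n x"
    have "\<exists>C. \<forall>x\<in>ball a r. V n i l x = C" for i l
    proof (rule has_derivative_zero_constant)
      fix x assume "x \<in> ball a r"
      then have "cball x (\<delta> n) \<subseteq> \<Omega>" using good by (auto simp: good_def)
      then have "partial_deriv k (V n i l) x = 0" for k
        unfolding V_partial_deriv_eq by (simp add: weak_gradient_zero)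
      then have "(V n i l has_derivative (\<lambda>h. 0)) (at x)"
        using has_derivative_partial_derivs[OF smooth_fun_differentiable[OF V_smooth], of n i l x] by simp
      then show "(V n i l has_derivative (\<lambda>h. 0)) (at x within ball a r)"
        by (rule has_derivative_at_withinI)
    qed simp
    then show "\<forall>x\<in>ball a r. \<forall>y\<in>ball a r. W n x = W n y"
      by (simp add: vec_eq_iff) metis
  qed
  have "AE x in lborel. x \<in> ball a r \<longrightarrow> (\<lambda>n. W n x) \<longlonglongrightarrow> F x"
    using W_tendsto by (rule eventually_mono) simp
  then obtain x0 where x0: "x0 \<in> ball a r" "(\<lambda>n. W n x0) \<longlonglongrightarrow> F x0"
    by (rule AE_lborel_openD) (use assms(1) in auto)
  have "AE x in lborel. x \<in> ball a r \<longrightarrow> F x = F x0"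
    using W_tendsto
  proof (rule eventually_mono, intro impI)
    fix x assume x: "(\<lambda>n. W n x) \<longlonglongrightarrow> F x" "x \<in> ball a r"
    have "\<forall>\<^sub>F n in sequentially. W n x0 = W n x"
      using const by (rule eventually_mono) (use x(2) x0(1) in blast)
    from LIMSEQ_unique[OF x(1) Lim_transform_eventually[OF x0(2) this]] show "F x = F x0" .
  qed
  then show ?thesis by (rule that)
qed

end

section \<open>Rigidity\<close>

lemma levi_civita_sum:
  fixes t :: "3 \<Rightarrow> 3 \<Rightarrow> real"
  assumes "cyclic3 j k l"
  shows "(\<Sum>k\<in>UNIV. \<Sum>l\<in>UNIV. levi_civita j k l * t k l) = t k l - t l k"
  using assms by (cases rule: cyclic3_cases) (simp_all add: sum_3 levi_civita_def)

lemma mat_1_SO3: "mat 1 \<in> SO3"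
  by (simp add: SO3_def)

lemma AE_lborel_lebesgue_on_iff:
  fixes S :: "'a::euclidean_space set"
  assumes "S \<in> sets lebesgue"
  shows "(AE x in lebesgue_on S. P x) \<longleftrightarrow> (AE x in lborel. x \<in> S \<longrightarrow> P x)"
proof -
  have "S \<inter> space lebesgue \<in> sets lebesgue" using assms by simp
  from AE_restrict_space_iff[OF this, of P] show ?thesis
    by (simp add: AE_completion_iff)
qed

text \<open>Overlapping balls meet in a nonempty open set, which is not null, so their constants
  agree and \<open>K\<close> is locally constant. The exceptional set is locally negligible, hence
  negligible.\<close>

lemma AE_constant_on_connected:
  fixes F :: "'a::euclidean_space \<Rightarrow> 'b"
  assumes \<Omega>: "open \<Omega>" "connected \<Omega>"
    and loc: "\<And>a. a \<in> \<Omega> \<Longrightarrow> \<exists>r>0. ball a r \<subseteq> \<Omega> \<and> (\<exists>C. AE x in lborel. x \<in> ball a r \<longrightarrow> F x = C)"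
  obtains C where "AE x in lborel. x \<in> \<Omega> \<longrightarrow> F x = C"
proof -
  obtain r K where rK: "\<And>a. a \<in> \<Omega> \<Longrightarrow> r a > 0" "\<And>a. a \<in> \<Omega> \<Longrightarrow> ball a (r a) \<subseteq> \<Omega>"
    "\<And>a. a \<in> \<Omega> \<Longrightarrow> AE x in lborel. x \<in> ball a (r a) \<longrightarrow> F x = K a"
    using loc by metis
  have "K constant_on \<Omega>"
  proof (rule locally_constant_imp_constant[OF \<Omega>(2)])
    fix a assume a: "a \<in> \<Omega>"
    have "K x = K a" if x: "x \<in> ball a (r a)" for x
    proof -
      have x\<Omega>: "x \<in> \<Omega>" using rK(2)[OF a] x by blast
      have "AE y in lborel. y \<in> ball a (r a) \<inter> ball x (r x) \<longrightarrow> K x = K a"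
        using rK(3)[OF a] rK(3)[OF x\<Omega>] by eventually_elim (metis IntD1 IntD2)
      then obtain y :: 'a where "K x = K a"
      proof (rule AE_lborel_openD)
        show "ball a (r a) \<inter> ball x (r x) \<noteq> {}" using x rK(1)[OF x\<Omega>] by auto
      qed auto
      then show ?thesis .
    qed
    moreover have "openin (top_of_set \<Omega>) (ball a (r a))"
      using rK(2)[OF a] \<Omega>(1) by (simp add: openin_open_eq)
    moreover have "a \<in> ball a (r a)" using rK(1)[OF a] by simp
    ultimately show "\<exists>T. openin (top_of_set \<Omega>) T \<and> a \<in> T \<and> (\<forall>x\<in>T. K x = K a)"
      by blast
  qed
  then obtain C where C: "\<And>a. a \<in> \<Omega> \<Longrightarrow> K a = C"
    unfolding constant_on_def by blast
  define S where "S = {x \<in> \<Omega>. F x \<noteq> C}"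
  have "negligible S"
  proof (subst locally_negligible_alt, intro ballI)
    fix a assume "a \<in> S"
    then have a: "a \<in> \<Omega>" by (simp add: S_def)
    have "AE x in lebesgue. x \<notin> S \<inter> ball a (r a)"
      unfolding AE_completion_iff using rK(3)[OF a] by eventually_elim (auto simp: S_def C[OF a])
    then obtain N where N: "N \<in> null_sets lebesgue" "{x \<in> S. dist a x < r a} \<subseteq> N"
      by (auto simp: eventually_ae_filter)
    have "negligible N"
      using N(1) by (simp only: negligible_iff_null_sets)
    moreover have "S \<inter> ball a (r a) \<subseteq> N" using N(2) by auto
    ultimately have "negligible (S \<inter> ball a (r a))"
      by (rule negligible_subset)
    moreover have "openin (top_of_set S) (S \<inter> ball a (r a))"
      by (simp add: openin_open_Int)
    ultimately show "\<exists>U. openin (top_of_set S) U \<and> a \<in> U \<and> negligible U"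
      using \<open>a \<in> S\<close> rK(1)[OF a] by (intro exI[of _ "S \<inter> ball a (r a)"]) auto
  qed
  then have "AE x in lebesgue. x \<notin> S"
    by (intro AE_not_in) (simp add: negligible_iff_null_sets)
  then have "AE x in lborel. x \<in> \<Omega> \<longrightarrow> F x = C"
    unfolding AE_completion_iff by (rule eventually_mono) (simp add: S_def)
  then show ?thesis by (rule that)
qed

text \<open>Each entry, extended by zero, agrees almost everywhere with a Borel function. Clamping
  to \<open>[-1, 1]\<close> and multiplying by the indicator of \<Omega> enforces the bounds at
  every point without changing values that already agree with \<open>R\<close>.\<close>

lemma borel_representative:
  fixes R :: "real^3 \<Rightarrow> real^3^3"
  assumes \<Omega>: "open \<Omega>" and R: "R \<in> borel_measurable (lebesgue_on \<Omega>)"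
    and bound: "\<And>x i l. x \<in> \<Omega> \<Longrightarrow> \<bar>R x $ i $ l\<bar> \<le> 1"
  obtains F where "\<And>i l. (\<lambda>x. F x $ i $ l) \<in> borel_measurable borel"
    and "\<And>i l x. \<bar>F x $ i $ l\<bar> \<le> 1" and "\<And>x. x \<notin> \<Omega> \<Longrightarrow> F x = 0"
    and "AE x in lborel. x \<in> \<Omega> \<longrightarrow> F x = R x"
proof -
  have "(\<lambda>x. R x $ i $ l) \<in> borel_measurable (lebesgue_on \<Omega>)" for i l
    using measurable_compose[OF R borel_measurable_continuous_onI[of "\<lambda>M. M $ i $ l"]]
    by (simp add: continuous_intros)
  then have "(\<lambda>x. if x \<in> \<Omega> then R x $ i $ l else 0) \<in> borel_measurable lebesgue" for i l
    using \<Omega> by (intro borel_measurable_if_I) auto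
  then have "\<forall>i l. \<exists>g. g \<in> borel_measurable lborel \<and>
      (AE x in lborel. (if x \<in> \<Omega> then R x $ i $ l else 0) = g x)"
    using completion_ex_borel_measurable_real by blast
  then obtain g where g: "\<And>i l. g i l \<in> borel_measurable lborel"
    "\<And>i l. AE x in lborel. (if x \<in> \<Omega> then R x $ i $ l else 0) = g i l x"
    unfolding choice_iff by blast
  define F :: "real^3 \<Rightarrow> real^3^3" where
    "F x = (\<chi> i l. max (- 1) (min 1 (g i l x)) * indicator \<Omega> x)" for x
  show ?thesis
  proof (rule that)
    have [measurable]: "g i l \<in> borel_measurable borel" for i l using g(1)[of i l] by simp
    have [measurable]: "\<Omega> \<in> sets borel" using \<Omega> by simp
    show "(\<lambda>x. F x $ i $ l) \<in> borel_measurable borel" for i l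
      unfolding F_def vec_lambda_beta by measurable
    show "\<bar>F x $ i $ l\<bar> \<le> 1" for x i l
      by (auto simp: F_def indicator_def)
    show "F x = 0" if "x \<notin> \<Omega>" for x
      using that by (simp add: F_def vec_eq_iff)
    have "AE x in lborel. \<forall>i l. (if x \<in> \<Omega> then R x $ i $ l else 0) = g i l x"
      using g(2) by (simp add: AE_all_countable)
    then show "AE x in lborel. x \<in> \<Omega> \<longrightarrow> F x = R x"
    proof (rule eventually_mono, intro impI)
      fix x assume x: "\<forall>i l. (if x \<in> \<Omega> then R x $ i $ l else 0) = g i l x" "x \<in> \<Omega>"
      then have "g i l x = R x $ i $ l" for i l by metis
      then show "F x = R x"
        using bound[OF x(2)] x(2) by (simp add: F_def vec_eq_iff abs_le_iff min_absorb2 max_absorb2 minus_le_iff)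
    qed
  qed
qed

text \<open>The weights vanish off \<Omega>, so the integral extends to all of space, and the null
  set where \<open>F\<close> and \<open>R\<close> differ does not contribute.\<close>

lemma integral_lebesgue_on_representative:
  fixes R F :: "real^3 \<Rightarrow> real^3^3"
  assumes \<Omega>: "open \<Omega>" and R: "R \<in> borel_measurable (lebesgue_on \<Omega>)"
    and F: "\<And>i l. (\<lambda>x. F x $ i $ l) \<in> borel_measurable borel" "AE x in lborel. x \<in> \<Omega> \<longrightarrow> F x = R x"
    and g: "g \<in> borel_measurable borel" "h \<in> borel_measurable borel"
      "\<And>x. x \<notin> \<Omega> \<Longrightarrow> g x = 0" "\<And>x. x \<notin> \<Omega> \<Longrightarrow> h x = 0"
  shows "(\<integral>x. R x $ i $ l * g x - R x $ i $ k * h x \<partial>lebesgue_on \<Omega>)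
    = (\<integral>x. F x $ i $ l * g x - F x $ i $ k * h x \<partial>lborel)"
proof -
  let ?F = "\<lambda>x. F x $ i $ l * g x - F x $ i $ k * h x"
  note [measurable] = F(1) g(1,2)
  have Fb: "?F \<in> borel_measurable borel" by measurable
  have \<Omega>': "\<Omega> \<inter> space lebesgue \<in> sets lebesgue" using \<Omega> by simp
  have b: "f \<in> borel_measurable (lebesgue_on \<Omega>)" if "f \<in> borel_measurable borel" for f :: "real^3 \<Rightarrow> real"
    using that by (intro measurable_restrict_space1 measurable_completion) simp
  have Rc: "(\<lambda>x. R x $ i $ l) \<in> borel_measurable (lebesgue_on \<Omega>)" for i l
    using measurable_compose[OF R borel_measurable_continuous_onI[of "\<lambda>M. M $ i $ l"]]
    by (simp add: continuous_intros)
  have "(\<integral>x. R x $ i $ l * g x - R x $ i $ k * h x \<partial>lebesgue_on \<Omega>) = (\<integral>x. ?F x \<partial>lebesgue_on \<Omega>)"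
  proof (rule integral_cong_AE)
    show "(\<lambda>x. R x $ i $ l * g x - R x $ i $ k * h x) \<in> borel_measurable (lebesgue_on \<Omega>)"
      by (intro borel_measurable_diff borel_measurable_times Rc b g)
    show "?F \<in> borel_measurable (lebesgue_on \<Omega>)" by (rule b[OF Fb])
    have "AE x in lborel. x \<in> \<Omega> \<longrightarrow> R x $ i $ l * g x - R x $ i $ k * h x = ?F x"
      using F(2) by (rule eventually_mono) simp
    then show "AE x in lebesgue_on \<Omega>. R x $ i $ l * g x - R x $ i $ k * h x = ?F x"
      using \<Omega> by (subst AE_lborel_lebesgue_on_iff) auto
  qed
  also have "\<dots> = (\<integral>x. indicator \<Omega> x *\<^sub>R ?F x \<partial>lebesgue)"
    by (rule integral_restrict_space[OF \<Omega>'])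
  also have "\<dots> = (\<integral>x. ?F x \<partial>lebesgue)"
    by (rule Bochner_Integration.integral_cong[OF refl]) (use g(3,4) in \<open>auto simp: indicator_def\<close>)
  also have "\<dots> = (\<integral>x. ?F x \<partial>lborel)"
    by (rule integral_completion) (use Fb in simp)
  finally show ?thesis .
qed

theorem theorem4p5:
  fixes \<Omega> :: "(real^3) set" and R :: "real^3 \<Rightarrow> real^3^3" and \<alpha> :: "real^3^3"
  assumes "open \<Omega>" and "bounded \<Omega>" and "connected \<Omega>"
    and "R \<in> borel_measurable (lebesgue_on \<Omega>)"
    and "\<And>x. x \<in> \<Omega> \<Longrightarrow> R x \<in> SO3"
    and "distrib_curl_eq \<Omega> R (\<lambda>x. \<alpha>)"
  shows "\<exists>R0 \<in> SO3. AE x in lebesgue_on \<Omega>. R x = R0"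
proof (cases "\<Omega> = {}")
  case True
  \<comment> \<open>On the empty domain any rotation can serve as the witness.\<close>
  then have "AE x in lebesgue_on \<Omega>. R x = mat 1"
    by (subst AE_lborel_lebesgue_on_iff) auto
  then show ?thesis using mat_1_SO3 by blast
next
  case False
  obtain F where F: "\<And>i l. (\<lambda>x. F x $ i $ l) \<in> borel_measurable borel"
    "\<And>i l x. \<bar>F x $ i $ l\<bar> \<le> 1" "\<And>x. x \<notin> \<Omega> \<Longrightarrow> F x = 0" "AE x in lborel. x \<in> \<Omega> \<longrightarrow> F x = R x"
    using borel_representative[OF assms(1,4) SO3_bound[OF assms(5)]] by blast
  obtain \<rho> where \<rho>: "\<forall>x\<in>\<Omega>. norm x \<le> \<rho>"
    using assms(2) by (auto simp: bounded_iff)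
  have vanish: "vanishes_beyond \<rho> (\<lambda>x. F x $ i $ l)" for i l
    unfolding vanishes_beyond_def using \<rho> F(3) by (metis not_le zero_index)
  \<comment> \<open>Index pairs form a finite type, so one subsequence handles all nine
    entries.\<close>
  obtain s where s: "strict_mono s"
    "AE x in lborel. \<forall>p::3\<times>3. (\<lambda>n. mollify (s n) (\<lambda>x. F x $ fst p $ snd p) x) \<longlonglongrightarrow> F x $ fst p $ snd p"
    by (rule mollify_AE_subseq[of "\<lambda>p x. F x $ fst p $ snd p" 1 \<rho>]) (use F(1,2) vanish in auto)
  interpret mollified_rotation \<Omega> F \<alpha> \<rho> s
  proof
    show "AE x in lborel. x \<in> \<Omega> \<longrightarrow> F x \<in> SO3"
      using F(4) by (rule eventually_mono) (simp add: assms(5))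
    show "AE x in lborel. \<forall>i l. (\<lambda>n. mollify (s n) (\<lambda>x. F x $ i $ l) x) \<longlonglongrightarrow> F x $ i $ l"
      using s(2) by (rule eventually_mono) simp
  next
    fix a :: "real^3" and r i j k l
    assume r: "r > 0" and ball: "cball a r \<subseteq> \<Omega>" and cyc: "cyclic3 j k l"
    have out: "bump a r x = 0" "partial_deriv k (bump a r) x = 0" if "x \<notin> \<Omega>" for x k
    proof -
      have "dist x a > r" using ball that by (force simp: dist_commute)
      then show "bump a r x = 0" "partial_deriv k (bump a r) x = 0"
        using r by (simp_all add: bump_eq_0 partial_deriv_bump_outside(1))
    qed
    have test: "test_fun \<Omega> (bump a r)" by (rule test_fun_bump[OF r ball])
    have "- (\<integral>x. (\<Sum>k\<in>UNIV. \<Sum>l\<in>UNIV. levi_civita j k l * (R x $ i $ l) * partial_deriv k (bump a r) x) \<partial>lebesgue_on \<Omega>)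
        = (\<integral>x. \<alpha> $ i $ j * bump a r x \<partial>lebesgue_on \<Omega>)"
      using assms(6) test unfolding distrib_curl_eq_def by blast
    \<comment> \<open>For fixed \<open>j\<close> only two index pairs have a nonzero sign.\<close>
    also have "(\<lambda>x. \<Sum>k\<in>UNIV. \<Sum>l\<in>UNIV. levi_civita j k l * (R x $ i $ l) * partial_deriv k (bump a r) x)
        = (\<lambda>x. R x $ i $ l * partial_deriv k (bump a r) x - R x $ i $ k * partial_deriv l (bump a r) x)"
      unfolding mult.assoc by (rule ext) (rule levi_civita_sum[OF cyc])
    also have "integral\<^sup>L (lebesgue_on \<Omega>) \<dots>
        = (\<integral>x. F x $ i $ l * partial_deriv k (bump a r) x - F x $ i $ k * partial_deriv l (bump a r) x \<partial>lborel)"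
      by (rule integral_lebesgue_on_representative[OF assms(1,4) F(1,4)])
        (simp_all add: out smooth_fun_borel smooth_fun_partial_deriv)
    also have "(\<integral>x. \<alpha> $ i $ j * bump a r x \<partial>lebesgue_on \<Omega>) = (\<integral>x. indicator \<Omega> x *\<^sub>R (\<alpha> $ i $ j * bump a r x) \<partial>lebesgue)"
      using assms(1) by (intro integral_restrict_space) simp
    also have "\<dots> = (\<integral>x. \<alpha> $ i $ j * bump a r x \<partial>lebesgue)"
      by (rule Bochner_Integration.integral_cong[OF refl]) (use out(1) in \<open>auto simp: indicator_def\<close>)
    also have "\<dots> = (\<integral>x. \<alpha> $ i $ j * bump a r x \<partial>lborel)"
      by (rule integral_completion) (simp add: smooth_fun_borel)
    finally show "(\<integral>x. F x $ i $ l * partial_deriv k (bump a r) x - F x $ i $ k * partial_deriv l (bump a r) x \<partial>lborel)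
      = - (\<alpha> $ i $ j * (\<integral>x. bump a r x \<partial>lborel))" by simp
  qed (use assms(1) F(1,2) vanish s(1) in auto)
  obtain R0 where "AE x in lborel. x \<in> \<Omega> \<longrightarrow> F x = R0"
  proof (rule AE_constant_on_connected[OF assms(1,3)])
    fix a assume "a \<in> \<Omega>"
    then obtain r where r: "r > 0" "cball a r \<subseteq> \<Omega>"
      using assms(1) open_contains_cball by blast
    then have "ball a r \<subseteq> \<Omega>" using ball_subset_cball by blast
    moreover obtain C where "AE x in lborel. x \<in> ball a r \<longrightarrow> F x = C"
      by (rule AE_constant_on_ball[OF r])
    ultimately show "\<exists>r>0. ball a r \<subseteq> \<Omega> \<and> (\<exists>C. AE x in lborel. x \<in> ball a r \<longrightarrow> F x = C)"
      using r(1) by blast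
  qed blast
  with F(4) have R0: "AE x in lborel. x \<in> \<Omega> \<longrightarrow> R x = R0"
    by eventually_elim simp
  \<comment> \<open>The constant is known only as an almost everywhere value; being attained at a
    point of the nonempty open domain makes it a rotation.\<close>
  then obtain x where "x \<in> \<Omega>" "R x = R0"
    by (rule AE_lborel_openD) (use assms(1) False in auto)
  then have "R0 \<in> SO3" using assms(5) by blast
  moreover have "AE x in lebesgue_on \<Omega>. R x = R0"
    using R0 assms(1) by (subst AE_lborel_lebesgue_on_iff) auto
  ultimately show ?thesis by blast
qed

end
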